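(* Let $A\in\mathbb{C}^{n\times n}$, $B\in\mathbb{C}^{m\times n}$, $C\in\mathbb{C}^{n\times m}$, $D\in\mathbb{C}^{m\times m}$, with $M,S,s,Z,z,E,M_E$ as in the context. Suppose that at least one of the following conditions holds: (1) $M_E^\#$ exists, and $M_E^e=E$; (2) $s^\#$ exists, and $s^e=A^e$; (3) $z^\#$ exists, and $z^e=D^e$; (4) $A^\pi+s$ is invertible; (5) $I+A^d(s-A)$ is invertible (or $I+A^d(S-I)A$ is invertible); (6) $s^d=(I+A^d(s-A))^{-1}A^d$; (7) $D^\pi+z$ is invertible; (8) $I+D^d(z-D)$ is invertible (or $I+D^d(Z-I)D$ is invertible); (9) $z^d=(I+D^d(z-D))^{-1}D^d$; (10) $s^\#,z^\#$ exist, $s^\#=A^dCz^\#BA^d+A^d$, and $A^dCz^\#=s^\#CD^d$; (11) $s^\#,z^\#$ exist, $z^\#=D^dBs^\#CD^d+D^d$, and $D^dBs^\#=z^\#BA^d$; (12) $M_E^\#$ exists, and $M_E^\#=\begin{bmatrix}A^d+A^dCz^\#BA^d&-A^dCz^\#\\ -z^\#BA^d&z^\#\end{bmatrix}=\begin{bmatrix}s^\#&-s^\#CD^d\\ -D^dBs^\#&D^dBs^\#CD^d+D^d\end{bmatrix}$. If moreover $A^\pi CD=0$ and $D^\pi BA=0$, then $$\begin{aligned}M^d={}&\left(\begin{bmatrix}A^\pi&0\\ 0&D^\pi\end{bmatrix}-P_1^\#\begin{bmatrix}0&A^eCD^\pi\\ D^eBA^\pi&0\end{bmatrix}\right)\\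 &\times\left[\begin{bmatrix}0&(A^\pi CB)^dA^\pi C\\ D^\pi B(A^\pi CB)^d&0\end{bmatrix}+\sum_{n=1}^{t-1}\begin{bmatrix}A^nA^\pi&0\\ 0&D^nD^\pi\end{bmatrix}\begin{bmatrix}0&(A^\pi CB)^dA^\pi C\\ D^\pi B(A^\pi CB)^d&0\end{bmatrix}^{n+1}\right]\\ &+\sum_{i=0}^{q-1}(P_1^\#)^{i+1}\left(I+P_1^\#\begin{bmatrix}0&A^eCD^\pi\\ D^eBA^\pi&0\end{bmatrix}\right)\begin{bmatrix}AA^\pi&A^\pi C\\ D^\pi B&DD^\pi\end{bmatrix}^i\\ &\times\left[\begin{bmatrix}(A^\pi CB)^\pi&0\\ 0&(D^\pi BC)^\pi\end{bmatrix}-\sum_{m=1}^{t-1}\begin{bmatrix}A^mA^\pi&0\\ 0&D^mD^\pi\end{bmatrix}\begin{bmatrix}0&(A^\pi CB)^dA^\pi C\\ D^\pi B(A^\pi CB)^d&0\end{bmatrix}^m\right],\end{aligned}$$ where $t=\max\{\mathrm{ind}(A),\mathrm{ind}(D)\}$, $q=\mathrm{ind}\left(\begin{bmatrix}AA^\pi&A^\pi C\\ D^\pi B&DD^\pi\end{bmatrix}\right)$, and $$P_1^\#=\begin{bmatrix}A^d+A^dCz^\#BA^d&-A^dCz^\#\\ -z^\#BA^d&z^\#\end{bmatrix}=\begin{bmatrix}s^\#&-s^\#CD^d\\ -D^dBs^\#&D^dBs^\#CD^d+D^d\end{bmatrix}.$$ (The summation indices $m,n$ are local and unrelated to the matrix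 sizes.)
   Context: All matrices are complex; $I$ is an identity matrix of the proper size. For a square matrix $X$: the Drazin inverse $X^d$ is the unique matrix with $XX^d=X^dX$, $X^dXX^d=X^d$, $X^k=X^{k+1}X^d$, where $k=\mathrm{ind}(X)$ is the smallest non-negative integer with $\mathrm{rank}(X^k)=\mathrm{rank}(X^{k+1})$ (it always exists). The group inverse $X^\#$, when it exists, is the unique matrix with $XX^\#X=X$, $X^\#XX^\#=X^\#$, $XX^\#=X^\#X$. Put $X^e=XX^d$, $X^\pi=I-X^e$, $X^0=I$. A sum whose upper limit is smaller than its lower limit is $0$. An equation containing a group inverse or an ordinary inverse includes the assertion that it exists. Notation: $S=A-CD^dB$, $s=A^eSA^e$, $Z=D-BA^dC$, $z=D^eZD^e$, $M=\begin{bmatrix}A&C\\ B&D\end{bmatrix}$, $E=\begin{bmatrix}A^e&0\\ 0&D^e\end{bmatrix}$, $M_E=EME=\begin{bmatrix}AA^e&A^eCD^e\\ D^eBA^e&DD^e\end{bmatrix}$. The matrix $P_1$ is $P_1=M_E$. *)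

theory Defs
  imports "HOL-Analysis.Analysis"
begin

(* Matrix powers are defined explicitly because the multiplication and the unit of the
   type 'a^'n^'n (and hence any class-based power) are entrywise; the matrix product is **
   and the identity matrix is mat 1. *)
primrec mat_pow :: "complex^'n^'n \<Rightarrow> nat \<Rightarrow> complex^'n^'n"  (infixr "^^^" 80) where
  "X ^^^ 0 = mat 1"
| "X ^^^ Suc k = X ** (X ^^^ k)"

definition mat_index :: "complex^'n^'n \<Rightarrow> nat" where
  "mat_index X = (LEAST k. rank (X ^^^ k) = rank (X ^^^ (k + 1)))"

definition is_drazin_inverse :: "complex^'n^'n \<Rightarrow> complex^'n^'n \<Rightarrow> bool" where
  "is_drazin_inverse X Y \<longleftrightarrow>
     X ** Y = Y ** X \<and> Y ** X ** Y = Y \<and>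
     X ^^^ mat_index X = X ^^^ (mat_index X + 1) ** Y"

definition drazin :: "complex^'n^'n \<Rightarrow> complex^'n^'n"  ("_\<^sup>d" [1000] 1000) where
  "X\<^sup>d = (THE Y. is_drazin_inverse X Y)"

definition drazin_idem :: "complex^'n^'n \<Rightarrow> complex^'n^'n"  ("_\<^sup>e" [1000] 1000) where
  "X\<^sup>e = X ** X\<^sup>d"

definition drazin_compl :: "complex^'n^'n \<Rightarrow> complex^'n^'n"  ("_\<^sup>\<pi>" [1000] 1000) where
  "X\<^sup>\<pi> = mat 1 - X\<^sup>e"

definition is_group_inverse :: "complex^'n^'n \<Rightarrow> complex^'n^'n \<Rightarrow> bool" where
  "is_group_inverse X Y \<longleftrightarrow>
     X ** Y ** X = X \<and> Y ** X ** Y = Y \<and> X ** Y = Y ** X"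

definition group_invertible :: "complex^'n^'n \<Rightarrow> bool" where
  "group_invertible X \<longleftrightarrow> (\<exists>Y. is_group_inverse X Y)"

(* Only meaningful under group_invertible X, which has to be asserted separately. *)
definition group_inv :: "complex^'n^'n \<Rightarrow> complex^'n^'n"  ("_\<^sup>#" [1000] 1000) where
  "X\<^sup># = (THE Y. is_group_inverse X Y)"

(* block P Q R T is the matrix with block rows (P, Q) and (R, T).  Recall that 'a^'c^'r is the
   type of matrices with rows indexed by 'r and columns indexed by 'c. *)
definition block ::
  "complex^'n^'n \<Rightarrow> complex^'m^'n \<Rightarrow> complex^'n^'m \<Rightarrow> complex^'m^'m \<Rightarrow>
   complex^('n + 'm)^('n + 'm)" where
  "block P Q R T = (\<chi> i j. case (i, j) of
       (Inl a, Inl b) \<Rightarrow> P $ a $ b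
     | (Inl a, Inr b) \<Rightarrow> Q $ a $ b
     | (Inr a, Inl b) \<Rightarrow> R $ a $ b
     | (Inr a, Inr b) \<Rightarrow> T $ a $ b)"

end

theory Submission
  imports Defs
begin

(* Since A^pi C D = 0 and D^pi B A = 0, the matrix N = (I - E) M satisfies N E = 0, so M is block
   triangular with respect to the idempotent E, with diagonal blocks M_E and N and with
   off-diagonal block F.  Each of the twelve conditions makes the Schur complement s (or z)
   invertible in the corner cut out by A^e (or D^e), hence M_E invertible in the corner cut out
   by E, and the triangular formula expresses M^d through P_1^# and N^d.  Finally N = J + K with J
   block diagonal and nilpotent, K block antidiagonal and K J = 0; G is the Drazin inverse
   of K, and N^d is the finite sum of the J^k G^(k+1). *)

section \<open>Matrix arithmetic and powers\<close>

text \<open>All twelve conditions reduce to one: \<open>s\<close> is a unit of the corner ring with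
  identity \<open>A\<^sup>e\<close>. There \<open>D\<^sup>d\<close> plays the part of the inverse of
  \<open>D\<close> in the corner of \<open>D\<^sup>e\<close>, so the Banachiewicz block inversion
  formula holds inside corners. The swap of (A, B, C, D) with (D, C, B, A) turns each fact about
  \<open>s\<close> into one about \<open>z\<close>, so only one side is argued. The index of a sum
  or of a block matrix cannot be read off from its parts. Drazin inverses are therefore recognised
  by their equations with an arbitrary exponent in place of the index. The sum over \<open>q\<close>
  in the formula merges two sums. The one from the summand \<open>mat 1\<close> collapses to its
  first term, because \<open>P ** N = 0\<close>; the one from \<open>P ** F\<close> solves the
  linear equation that makes the off-diagonal corner of the candidate commute with
  \<open>M\<close>.\<close>

lemma matrix_add_rdistrib: "(X + Y) ** Z = X ** Z + Y ** Z" for X :: "'a::semiring_1^'n^'m"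
  by (simp add: matrix_matrix_mult_def vec_eq_iff distrib_right sum.distrib)

lemma matrix_diff_ldistrib: "X ** (Y - Z) = X ** Y - X ** Z" for X :: "'a::ring_1^'n^'m"
  by (simp add: matrix_matrix_mult_def vec_eq_iff right_diff_distrib sum_subtractf)

lemma matrix_diff_rdistrib: "(X - Y) ** Z = X ** Z - Y ** Z" for X :: "'a::ring_1^'n^'m"
  by (simp add: matrix_matrix_mult_def vec_eq_iff left_diff_distrib sum_subtractf)

lemma matrix_mul_lneg: "(- X) ** Y = - (X ** Y)" for X :: "'a::ring_1^'n^'m"
  by (simp add: matrix_matrix_mult_def vec_eq_iff sum_negf)

lemma matrix_mul_rneg: "X ** (- Y) = - (X ** Y)" for X :: "'a::ring_1^'n^'m"
  by (simp add: matrix_matrix_mult_def vec_eq_iff sum_negf)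

lemma matrix_mul_lzero: "0 ** X = 0" for X :: "'a::ring_1^'n^'m"
  by (simp add: matrix_matrix_mult_def vec_eq_iff)

lemma matrix_mul_rzero: "X ** 0 = 0" for X :: "'a::ring_1^'n^'m"
  by (simp add: matrix_matrix_mult_def vec_eq_iff)

lemma matrix_sum_ldistrib: "X ** (\<Sum>i\<in>I. f i) = (\<Sum>i\<in>I. X ** f i)" for X :: "'a::ring_1^'n^'m"
  by (induction I rule: infinite_finite_induct) (simp_all add: matrix_mul_rzero matrix_add_ldistrib)

lemma matrix_sum_rdistrib: "(\<Sum>i\<in>I. f i) ** X = (\<Sum>i\<in>I. f i ** X)" for X :: "'a::ring_1^'n^'m"
  by (induction I rule: infinite_finite_induct) (simp_all add: matrix_mul_lzero matrix_add_rdistrib)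

lemmas matrix_ring_simps =
  matrix_add_ldistrib matrix_add_rdistrib matrix_diff_ldistrib matrix_diff_rdistrib
  matrix_mul_lneg matrix_mul_rneg matrix_mul_lzero matrix_mul_rzero
  matrix_mul_assoc[symmetric]

text \<open>Products are kept nested to the right, where \<open>X ** Y\<close> is no subterm of
  \<open>X ** (Y ** W)\<close>. Applied with \<open>THEN\<close>, this gives each rewrite rule a
  second form that fires there.\<close>

lemma matrix_mul_left_cong: "X ** Y = Z \<Longrightarrow> X ** (Y ** W) = Z ** W"
  by (simp add: matrix_mul_assoc)

lemma mat_pow_add: "X ^^^ (i + j) = X ^^^ i ** X ^^^ j"
  by (induction i) (simp_all add: matrix_mul_assoc)

lemma mat_pow_commute: "X ** Y = Y ** X \<Longrightarrow> X ^^^ k ** Y = Y ** X ^^^ k"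
proof (induction k)
  case (Suc k)
  then show ?case
    by (metis mat_pow.simps(2) matrix_mul_assoc)
qed simp

lemma mat_pow_Suc_right: "X ^^^ Suc k = X ^^^ k ** X"
  by (simp add: mat_pow_commute)

lemma transpose_mat_pow: "transpose (X ^^^ k) = transpose X ^^^ k"
proof (induction k)
  case (Suc k)
  then show ?case
    by (simp add: mat_pow_Suc_right matrix_transpose_mul mat_pow_commute)
qed simp

section \<open>Existence and uniqueness of the Drazin inverse\<close>

lemma range_matrix_subset_imp_factor:
  fixes P :: "'a::field^'n^'m" and Q :: "'a^'k^'m"
  assumes "range ((*v) P) \<subseteq> range ((*v) Q)"
  obtains U where "P = Q ** U"
proof -
  have "\<exists>u. Q *v u = P *v axis j 1" for j
    using assms by (metis image_iff rangeI subsetD)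
  then obtain u where u: "\<And>j. Q *v u j = P *v axis j 1"
    by metis
  define U where "U = (\<chi> i j. u j $ i)"
  have "P $ i $ j = (Q ** U) $ i $ j" for i j
  proof -
    have "P $ i $ j = (P *v axis j 1) $ i"
      by (simp add: matrix_vector_mult_def axis_def if_distrib cong: if_cong)
    also have "\<dots> = (Q ** U) $ i $ j"
      by (simp add: u[symmetric]) (simp add: matrix_vector_mult_def matrix_matrix_mult_def U_def)
    finally show ?thesis .
  qed
  then have "P = Q ** U"
    by (simp add: vec_eq_iff)
  then show ?thesis
    by (rule that)
qed

section \<open>Row and column spaces of powers\<close>

lemma vec_subspace_range: "vec.subspace (range ((*v) P))" for P :: "'a::field^'n^'m"
  using vec.linear_subspace_image[OF matrix_vector_mul_linear_gen vec.subspace_UNIV] .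

lemma span_columns: "vec.span (columns P) = range ((*v) P)" for P :: "'a::field^'n^'m"
proof
  have "column j P = P *v axis j 1" for j
    by (simp add: vec_eq_iff column_def matrix_vector_mult_def axis_def if_distrib cong: if_cong)
  then show "vec.span (columns P) \<subseteq> range ((*v) P)"
    by (intro vec.span_minimal vec_subspace_range) (auto simp: columns_def)
qed (use matrix_vector_mult_in_columnspace_gen in blast)

text \<open>\<open>rank\<close> is accessed as row rank, hence the transpose; for the same reason
  the left factorisation of powers below precedes the right one.\<close>

lemma rank_eq_dim_range_transpose: "rank P = vec.dim (range ((*v) (transpose P)))" for P :: "'a::field^'n^'m"
  by (metis columns_transpose row_rank_def_gen span_columns vec.dim_span)

lemma range_mat_pow_Suc: "range ((*v) (X ^^^ Suc k)) \<subseteq> range ((*v) (X ^^^ k))"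
  by (auto simp: mat_pow_Suc_right simp flip: matrix_vector_mul_assoc simp del: mat_pow.simps)

lemma rank_mat_pow_Suc: "rank (X ^^^ Suc k) \<le> rank (X ^^^ k)"
  unfolding rank_eq_dim_range_transpose transpose_mat_pow
  by (intro vec.dim_subset range_mat_pow_Suc)

text \<open>The \<open>LEAST\<close> in \<open>mat_index\<close> is attained: the ranks of the
  powers are non-increasing natural numbers, which cannot drop strictly forever.\<close>

lemma rank_mat_index: "rank (X ^^^ mat_index X) = rank (X ^^^ (mat_index X + 1))"
proof -
  have "\<exists>k. rank (X ^^^ k) = rank (X ^^^ (k + 1))"
  proof (rule ccontr)
    assume "\<not> ?thesis"
    then have less: "rank (X ^^^ Suc k) < rank (X ^^^ k)" for k
      using rank_mat_pow_Suc[of X k] by (metis Suc_eq_plus1 le_neq_implies_less)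
    have "rank (X ^^^ k) + k \<le> rank (X ^^^ 0)" for k
    proof (induction k)
      case (Suc k)
      then show ?case using less[of k] by linarith
    qed simp
    from this[of "Suc (rank (X ^^^ 0))"] show False by simp
  qed
  then show ?thesis
    unfolding mat_index_def by (rule LeastI_ex)
qed

text \<open>At the index the nested row spaces of the two powers have equal dimension and coincide,
  so the rows of the lower power are combinations of those of the higher one.\<close>

lemma mat_pow_index_left_factor:
  obtains V where "X ^^^ mat_index X = V ** X ^^^ (mat_index X + 1)"
proof -
  let ?k = "mat_index X" and ?T = "transpose X"
  have "range ((*v) (?T ^^^ Suc ?k)) = range ((*v) (?T ^^^ ?k))"
    using rank_mat_index[of X]
    unfolding rank_eq_dim_range_transpose transpose_mat_pow Suc_eq_plus1[symmetric]
    by (intro vec.subspace_dim_equal vec_subspace_range range_mat_pow_Suc) (rule eq_imp_le)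
  then obtain U where "?T ^^^ ?k = ?T ^^^ Suc ?k ** U"
    by (metis range_matrix_subset_imp_factor order_refl)
  then have "transpose (X ^^^ ?k) = transpose (transpose U ** X ^^^ (?k + 1))"
    by (simp add: transpose_mat_pow matrix_transpose_mul mat_pow_commute matrix_mul_assoc)
  then show ?thesis
    using that transpose_iff by blast
qed

text \<open>Stabilisation passes from row spaces to column spaces: the left factor \<open>V\<close>
  undoes \<open>X\<close> on the range of \<open>X ^^^ mat_index X\<close>, so \<open>X\<close> maps
  this range injectively onto the next one, which is contained in it and has the same
  dimension.\<close>

lemma mat_pow_index_right_factor:
  obtains U where "X ^^^ mat_index X = X ^^^ (mat_index X + 1) ** U"
proof -
  let ?k = "mat_index X"
  obtain V where V: "X ^^^ ?k = V ** X ^^^ (?k + 1)"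
    by (rule mat_pow_index_left_factor)
  have V': "V *v (X *v y) = y" if "y \<in> range ((*v) (X ^^^ ?k))" for y
  proof -
    from that obtain x where "y = X ^^^ ?k *v x" by blast
    then show ?thesis
      by (metis V Suc_eq_plus1 mat_pow.simps(2) matrix_mul_assoc matrix_vector_mul_assoc)
  qed
  have "(*v) X ` range ((*v) (X ^^^ ?k)) = range ((*v) (X ^^^ Suc ?k))"
    by (simp add: image_image matrix_vector_mul_assoc)
  moreover have "inj_on ((*v) X) (vec.span (range ((*v) (X ^^^ ?k))))"
    unfolding vec.span_eq_iff[THEN iffD2, OF vec_subspace_range]
    by (rule inj_on_inverseI[of _ "(*v) V"]) (rule V')
  ultimately have "vec.dim (range ((*v) (X ^^^ Suc ?k))) = vec.dim (range ((*v) (X ^^^ ?k)))"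
    by (metis vec.dim_image_eq matrix_vector_mul_linear_gen)
  then have "range ((*v) (X ^^^ Suc ?k)) = range ((*v) (X ^^^ ?k))"
    by (intro vec.subspace_dim_equal vec_subspace_range range_mat_pow_Suc) simp
  then show ?thesis
    using that by (metis range_matrix_subset_imp_factor order_refl Suc_eq_plus1)
qed

text \<open>Once both exponents are raised to a common \<open>n\<close>, each inverse equals
  \<open>Y ** X ** Z\<close>: \<open>Y\<close> because \<open>Y ^^^ (n + 1) ** X ^^^ n\<close>
  absorbs \<open>X ** Z\<close> on the right, and \<open>Z\<close> by the mirrored argument.\<close>

lemma drazin_inverse_unique:
  assumes Y: "X ** Y = Y ** X" "Y ** X ** Y = Y" "X ^^^ k = X ^^^ (k + 1) ** Y"
    and Z: "X ** Z = Z ** X" "Z ** X ** Z = Z" "X ^^^ l = X ^^^ (l + 1) ** Z"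
  shows "Y = Z"
proof -
  have pow: "W = X ^^^ j ** W ^^^ (j + 1)" "W = W ^^^ (j + 1) ** X ^^^ j"
    if W: "X ** W = W ** X" "W ** X ** W = W" for W j
  proof -
    show "W = W ^^^ (j + 1) ** X ^^^ j"
    proof (induction j)
      case (Suc j)
      have "W ^^^ (Suc j + 1) ** X ^^^ Suc j = W ** (W ^^^ (j + 1) ** X ^^^ j) ** X"
        by (simp only: mat_pow_Suc_right[of X] add_Suc mat_pow.simps(2)[of W "j + 1"] matrix_mul_assoc)
      then show ?case using Suc W by (metis matrix_mul_assoc)
    qed simp
    then show "W = X ^^^ j ** W ^^^ (j + 1)"
      using W(1) by (metis mat_pow_commute)
  qed
  have shift: "X ^^^ n = X ^^^ (n + 1) ** W" if "X ^^^ j = X ^^^ (j + 1) ** W" "j \<le> n" for W j n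
  proof -
    have "X ^^^ n = X ^^^ (n - j) ** X ^^^ j"
      using that(2) by (simp flip: mat_pow_add)
    also have "\<dots> = X ^^^ (n - j + (j + 1)) ** W"
      by (subst that(1)) (simp only: mat_pow_add matrix_mul_assoc)
    finally show ?thesis using that(2) by simp
  qed
  define n where "n = max k l"
  have nY: "X ^^^ n = X ^^^ (n + 1) ** Y" and nZ: "X ^^^ n = X ^^^ (n + 1) ** Z"
    using shift[OF Y(3), of n] shift[OF Z(3), of n] by (auto simp: n_def)
  have "Y = Y ^^^ (n + 1) ** X ^^^ n"
    using pow(2) Y by blast
  also have "\<dots> = Y ^^^ (n + 1) ** X ^^^ n ** X ** Z"
    by (subst nZ) (simp only: Suc_eq_plus1[symmetric] mat_pow_Suc_right[of X] matrix_mul_assoc)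
  also have "\<dots> = Y ** X ** Z"
    using pow(2)[of Y n] Y by metis
  also have "\<dots> = Y ** X ^^^ (n + 1) ** Z ^^^ (n + 1)"
    using pow(1)[of Z n] Z by (metis Suc_eq_plus1 mat_pow.simps(2) matrix_mul_assoc)
  also have "\<dots> = X ^^^ n ** Z ^^^ (n + 1)"
    using nY Y(1) by (metis mat_pow_commute)
  also have "\<dots> = Z"
    using pow(1)[of Z n] Z by metis
  finally show ?thesis .
qed

text \<open>Strong \<open>\<pi>\<close>-regularity: with \<open>X\<^sup>k = X\<^sup>k\<^sup>+\<^sup>1 U = V X\<^sup>k\<^sup>+\<^sup>1\<close>, the Drazin inverse is
  \<open>X\<^sup>k U\<^sup>k\<^sup>+\<^sup>1 = V\<^sup>k\<^sup>+\<^sup>1 X\<^sup>k\<close>.\<close>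

lemma is_drazin_inverse_drazin: "is_drazin_inverse X X\<^sup>d"
proof -
  let ?k = "mat_index X"
  obtain V where V: "X ^^^ ?k = V ** X ^^^ (?k + 1)"
    by (rule mat_pow_index_left_factor)
  obtain U where U: "X ^^^ ?k = X ^^^ (?k + 1) ** U"
    by (rule mat_pow_index_right_factor)
  have Vj: "V ^^^ j ** X ^^^ (?k + j) = X ^^^ ?k" for j
  proof (induction j)
    case (Suc j)
    have "V ^^^ Suc j ** X ^^^ (?k + Suc j) = V ^^^ j ** (V ** X ^^^ (?k + 1)) ** X ^^^ j"
      unfolding mat_pow_Suc_right[of V] matrix_mul_assoc[symmetric] mat_pow_add[symmetric] by simp
    also have "\<dots> = V ^^^ j ** X ^^^ (?k + j)"
      unfolding V[symmetric] by (simp add: mat_pow_add matrix_mul_assoc)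
    finally show ?case using Suc by simp
  qed simp
  have Uj: "X ^^^ (j + ?k) ** U ^^^ j = X ^^^ ?k" for j
  proof (induction j)
    case (Suc j)
    have "X ^^^ (Suc j + ?k) ** U ^^^ Suc j = X ^^^ j ** (X ^^^ (?k + 1) ** U) ** U ^^^ j"
      by (simp only: mat_pow.simps(2)[of U] matrix_mul_assoc mat_pow_add[symmetric]) simp
    also have "\<dots> = X ^^^ (j + ?k) ** U ^^^ j"
      unfolding U[symmetric] by (simp add: mat_pow_add matrix_mul_assoc)
    finally show ?case using Suc by simp
  qed simp
  \<comment> \<open>Bracket \<open>V ^^^ j ** X ^^^ (?k + j) ** U ^^^ j\<close> in the two possible
    ways.\<close>
  have VU: "V ^^^ j ** X ^^^ ?k = X ^^^ ?k ** U ^^^ j" for j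
    by (metis Vj Uj matrix_mul_assoc add.commute)
  define Y where "Y = X ^^^ ?k ** U ^^^ (?k + 1)"
  have Y': "Y = V ^^^ (?k + 1) ** X ^^^ ?k"
    unfolding Y_def by (rule VU[symmetric])
  have "X ** Y = (X ^^^ (?k + 1) ** U) ** U ^^^ ?k"
    unfolding Y_def by (simp add: matrix_mul_assoc)
  also have "\<dots> = X ^^^ ?k ** U ^^^ ?k"
    unfolding U[symmetric] ..
  also have "\<dots> = V ^^^ ?k ** X ^^^ ?k"
    by (rule VU[symmetric])
  also have "\<dots> = V ^^^ ?k ** (V ** X ^^^ (?k + 1))"
    unfolding V[symmetric] ..
  also have "\<dots> = Y ** X"
    unfolding Y'
    by (simp only: Suc_eq_plus1[symmetric] mat_pow_Suc_right[of V] mat_pow_Suc_right[of X] matrix_mul_assoc)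
  finally have comm: "X ** Y = Y ** X" .
  have pow: "Y ** X ^^^ (?k + 1) = X ^^^ ?k"
    unfolding Y' matrix_mul_assoc[symmetric] mat_pow_add[symmetric] by (rule Vj)
  have "Y ** X ** Y = Y ** X ^^^ (?k + 1) ** U ^^^ (?k + 1)"
    by (simp add: Y_def matrix_mul_assoc)
  then have "Y ** X ** Y = Y"
    unfolding pow Y_def[symmetric] .
  then have Y: "is_drazin_inverse X Y"
    unfolding is_drazin_inverse_def using comm pow mat_pow_commute[OF comm, of "?k + 1"] by metis
  then show ?thesis
    unfolding drazin_def
    by (rule theI) (use Y drazin_inverse_unique in \<open>unfold is_drazin_inverse_def, blast\<close>)
qed

lemma drazin_commute: "X ** X\<^sup>d = X\<^sup>d ** X"
  and drazin_outer: "X\<^sup>d ** X ** X\<^sup>d = X\<^sup>d"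
  and drazin_index: "X ^^^ mat_index X = X ^^^ (mat_index X + 1) ** X\<^sup>d"
  using is_drazin_inverse_drazin[of X] by (auto simp: is_drazin_inverse_def)

text \<open>The exponent \<open>k\<close> is free and need not be the index, so a candidate can be
  verified without knowing the index of \<open>X\<close>.\<close>

lemma drazin_eqI:
  assumes "X ** Y = Y ** X" "Y ** X ** Y = Y" "X ^^^ k = X ^^^ (k + 1) ** Y"
  shows "X\<^sup>d = Y"
  using drazin_inverse_unique[OF drazin_commute drazin_outer drazin_index assms] .

section \<open>Drazin inverses of sums\<close>

text \<open>Inversion in the corner ring with identity \<open>e\<close>. Idempotence of
  \<open>e\<close> is forced: \<open>e ** e = e ** (x ** y) = x ** y = e\<close>.\<close>

definition corner_inverse :: "complex^'n^'n \<Rightarrow> complex^'n^'n \<Rightarrow> complex^'n^'n \<Rightarrow> bool" where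
  "corner_inverse e x y \<longleftrightarrow>
     e ** x = x \<and> x ** e = x \<and> e ** y = y \<and> y ** e = y \<and> x ** y = e \<and> y ** x = e"

lemma mat_pow_mul_compl: "X ^^^ k ** (mat 1 - X ** Y) = X ^^^ k - X ^^^ (k + 1) ** Y"
  by (simp add: matrix_diff_ldistrib matrix_mul_assoc mat_pow_commute)

text \<open>The hypothesis on \<open>M ** E\<close> says that the range of \<open>E\<close> is
  invariant, so \<open>M\<close> is upper triangular with diagonal parts \<open>E ** M ** E\<close>
  and \<open>N\<close> and corner \<open>F\<close>. This is the Drazin inverse of a triangular
  matrix whose first diagonal block is invertible.\<close>

lemma drazin_triangular:
  assumes inv: "corner_inverse E (E ** M ** E) P" and ME: "M ** E = E ** M ** E"
    and N: "N = M - E ** M" and F: "F = E ** M - E ** M ** E"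
    and Y: "N ** Y = Y ** N" "Y ** N ** Y = Y" "N ^^^ q = N ^^^ (q + 1) ** Y"
  shows "M\<^sup>d = (mat 1 - E - P ** F) ** Y +
    (\<Sum>i\<in>{0..<q}. P ^^^ (i + 1) ** (mat 1 + P ** F) ** N ^^^ i ** (mat 1 - N ** Y))"
proof -
  define T where "T = E ** M ** E"
  define W where "W = mat 1 - N ** Y"
  have P: "E ** P = P" "P ** E = P" "T ** P = E" "P ** T = E" "E ** T = T" "T ** E = T"
    using inv unfolding corner_inverse_def T_def by auto
  have EE: "E ** E = E"
    using P by (metis matrix_mul_assoc)
  have M: "M = T + F + N"
    by (simp add: T_def N F)
  have EN: "E ** N = 0" and NE: "N ** E = 0" and EF: "E ** F = F" and FE: "F ** E = 0"
    using ME EE by (auto simp: N F matrix_ring_simps EE[THEN matrix_mul_left_cong])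
  have EY: "E ** Y = 0"
    by (metis EN Y(1,2) matrix_mul_assoc matrix_mul_lzero)
  have YE: "Y ** E = 0"
    by (metis NE Y(1,2) matrix_mul_assoc matrix_mul_rzero)
  have zero: "P ** N = 0" "N ** P = 0" "T ** N = 0" "N ** T = 0" "F ** P = 0" "F ** T = 0"
      "F ** F = 0" "N ** F = 0" "T ** Y = 0" "Y ** T = 0" "P ** Y = 0" "Y ** P = 0" "Y ** F = 0"
    by (metis P EN NE EF FE EY YE matrix_mul_assoc matrix_mul_lzero matrix_mul_rzero)+
  have NYY: "N ** (Y ** Y) = Y"
    using Y(1,2) by (simp add: matrix_mul_assoc)
  have W: "W ** E = E" "E ** W = E" "W ** Y = 0" "W ** N = N ** W" "N ^^^ q ** W = 0"
  proof -
    show "W ** E = E" "E ** W = E" "W ** Y = 0" "W ** N = N ** W"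
      by (simp_all add: W_def matrix_ring_simps YE NYY EN[THEN matrix_mul_left_cong] Y(1)[symmetric])
    show "N ^^^ q ** W = 0"
      unfolding W_def mat_pow_mul_compl Y(3)[symmetric] by simp
  qed
  define u where "u i = P ^^^ (i + 1) ** F ** N ^^^ i ** W" for i
  define U where "U = (\<Sum>i<q. u i)"
  have NW: "N ^^^ i ** W = W ** N ^^^ i" for i
    by (rule mat_pow_commute) (simp add: W)
  have u_Suc: "u (Suc i) = P ** u i ** N" for i
    unfolding u_def mat_pow_Suc_right[of N i] add_Suc mat_pow.simps(2)[of P "i + 1"]
    by (simp only: matrix_mul_assoc[symmetric] W(4))
  \<comment> \<open>Multiplying by \<open>P\<close> on the left and \<open>N\<close> on the right
    shifts the index by one; the new top term vanishes since \<open>N ^^^ q ** W = 0\<close>. The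
    resulting fixed-point equation \<open>U_rec\<close> is exactly what makes \<open>X ** M\<close>
    equal to \<open>M ** X\<close>.\<close>
  have "u 0 + P ** U ** N = (\<Sum>i<Suc q. u i)"
    unfolding sum.lessThan_Suc_shift U_def
    by (simp add: u_Suc matrix_sum_ldistrib matrix_sum_rdistrib)
  also have "\<dots> = U"
    using W(5) by (simp add: U_def u_def matrix_mul_assoc[symmetric] matrix_mul_rzero)
  finally have U_rec: "P ** (F ** W) + P ** (U ** N) = U"
    by (simp add: u_def matrix_mul_assoc)
  have FNE: "F ** N ^^^ i ** E = 0" for i
    using FE NE by (cases i) (simp_all add: mat_pow_Suc_right matrix_mul_rzero matrix_mul_assoc[symmetric] del: mat_pow.simps(2))
  have U: "E ** U = U" "U ** E = 0" "U ** Y = 0" "U ** N ^^^ q = 0"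
  proof -
    show "E ** U = U"
      using P by (simp add: U_def u_def matrix_sum_ldistrib matrix_mul_assoc)
    have "u i ** E = 0" for i
      using W FNE by (metis u_def matrix_mul_assoc matrix_mul_rzero)
    then show "U ** E = 0"
      by (simp add: U_def matrix_sum_rdistrib)
    show "U ** Y = 0"
      using W by (simp add: U_def u_def matrix_sum_rdistrib matrix_mul_assoc[symmetric] matrix_mul_rzero)
    have "u i ** N ^^^ q = 0" for i
      using W(5) NW by (metis u_def matrix_mul_assoc matrix_mul_rzero)
    then show "U ** N ^^^ q = 0"
      by (simp add: U_def matrix_sum_rdistrib)
  qed
  have U': "U ** P = 0" "U ** T = 0" "U ** F = 0" "N ** U = 0" "F ** U = 0" "Y ** U = 0" "U ** U = 0"
    by (metis U P NE FE EF YE matrix_mul_assoc matrix_mul_lzero matrix_mul_rzero)+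
  note all_rules = P EN NE EF FE EY YE zero NYY Y(1)[symmetric] U U' EE
  note rules = all_rules all_rules[THEN matrix_mul_left_cong] matrix_ring_simps
  \<comment> \<open>Relative to \<open>E\<close>, the diagonal blocks are \<open>P\<close> and
    \<open>Y\<close>, and the upper corner is \<open>P ** U - P ** (F ** Y)\<close>.\<close>
  define X where "X = P + Y - P ** (F ** Y) + P ** U"
  have MX: "M ** X = E + N ** Y + U"
    unfolding M X_def by (simp add: rules)
  have "X ** M = E + N ** Y + (P ** (F ** W) + P ** (U ** N))"
    unfolding M X_def W_def by (simp add: rules)
  then have XM: "X ** M = E + N ** Y + U"
    unfolding U_rec .
  \<comment> \<open>\<open>V\<close> is the candidate for \<open>M\<^sup>\<pi>\<close>. It satisfies
    \<open>V ** M = V ** N\<close>, and \<open>N ** M = N ** N\<close>, so \<open>V\<close> sees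
    only powers of \<open>N\<close> and the exponent \<open>q\<close> of \<open>N\<close> serves for
    \<open>M\<close> too.\<close>
  define V where "V = mat 1 - (E + N ** Y + U)"
  have VM: "V ** M = V ** N"
    unfolding M V_def by (simp add: rules)
  have comm: "X ** M = M ** X"
    by (simp only: MX XM)
  have V1: "V = mat 1 - M ** X"
    by (simp only: V_def MX)
  have MV: "M ** V = V ** M"
    unfolding V1 by (simp only: matrix_diff_ldistrib matrix_diff_rdistrib matrix_mul_lid matrix_mul_rid
        matrix_mul_assoc[symmetric] comm)
  have NM: "N ** M = N ** N"
    unfolding M by (simp add: rules)
  have NMi: "N ** M ^^^ i = N ** N ^^^ i" for i
  proof (induction i)
    case (Suc i)
    have "N ** M ^^^ Suc i = N ** M ** M ^^^ i"
      by (simp add: matrix_mul_assoc)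
    then show ?case
      using Suc by (simp add: NM matrix_mul_assoc[symmetric])
  qed simp
  have VMi: "V ** M ^^^ i = V ** N ^^^ i" for i
    by (cases i) (simp_all add: VM[THEN matrix_mul_left_cong] NMi matrix_mul_assoc[symmetric])
  \<comment> \<open>Passing through \<open>W\<close> also covers \<open>q = 0\<close>, where
    \<open>E ** N = 0\<close> says nothing about \<open>N ^^^ 0\<close>.\<close>
  have "E ** N ^^^ q = E ** W ** N ^^^ q"
    using W by simp
  also have "\<dots> = 0"
    using NW W(5) by (simp add: matrix_mul_assoc[symmetric] matrix_mul_rzero)
  finally have EN0: "E ** N ^^^ q = 0" .
  have "V = W - E - U"
    by (simp add: V_def W_def)
  then have "V ** N ^^^ q = 0"
    by (simp only: matrix_diff_rdistrib U EN0 W(5) NW[symmetric] diff_self)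
  then have "M ^^^ q ** V = 0"
    using VMi MV by (metis mat_pow_commute)
  then have "M ^^^ q = M ^^^ (q + 1) ** X"
    unfolding V1 mat_pow_mul_compl by (rule eq_iff_diff_eq_0[THEN iffD2])
  moreover have "X ** M ** X = X"
    unfolding XM by (simp add: X_def rules)
  ultimately have "M\<^sup>d = X"
    by (intro drazin_eqI[of M X q]) (simp_all only: MX XM)
  \<comment> \<open>Only the term \<open>i = 0\<close> survives, by \<open>P ** N = 0\<close>. An
    empty sum is harmless: \<open>q = 0\<close> forces \<open>W = 0\<close>, hence
    \<open>E = E ** W = 0\<close> and \<open>P = 0\<close>.\<close>
  moreover have "(\<Sum>i\<in>{0..<q}. P ^^^ (i + 1) ** N ^^^ i ** W) = P"
  proof (cases q)
    case 0
    then have "W = 0"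
      using W(5) by simp
    then have "E = 0"
      using W(2) by (simp add: matrix_mul_rzero)
    then have "P = 0"
      using P(1) by (simp add: matrix_mul_lzero)
    with 0 show ?thesis
      by simp
  next
    case (Suc r)
    have "P ^^^ (i + 1) ** N ^^^ i ** W = (if i = 0 then P else 0)" for i
    proof (cases i)
      case 0
      have "P ** W = P" by (metis P(2) W(2) matrix_mul_assoc)
      with 0 show ?thesis by simp
    next
      case (Suc j)
      have "P ^^^ (i + 1) ** N ^^^ i = P ^^^ i ** (P ** N) ** N ^^^ j"
        unfolding Suc by (simp only: Suc_eq_plus1[symmetric] mat_pow_Suc_right[of P "Suc j"]
          mat_pow.simps(2)[of N] matrix_mul_assoc)
      then show ?thesis
        using Suc zero by (simp add: matrix_mul_rzero matrix_mul_lzero)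
    qed
    then show ?thesis
      using Suc by simp
  qed
  moreover have "(\<Sum>i\<in>{0..<q}. P ^^^ (i + 1) ** P ** F ** N ^^^ i ** W) = P ** U"
  proof -
    have "P ^^^ (i + 1) ** P = P ** P ^^^ (i + 1)" for i
      by (rule mat_pow_commute) simp
    then have "P ^^^ (i + 1) ** P ** F ** N ^^^ i ** W = P ** u i" for i
      by (simp only: u_def matrix_mul_assoc)
    then show ?thesis
      by (simp only: U_def matrix_sum_ldistrib lessThan_atLeast0)
  qed
  ultimately show ?thesis
    by (simp add: X_def matrix_add_ldistrib matrix_add_rdistrib matrix_diff_rdistrib matrix_mul_assoc EY sum.distrib
        flip: W_def)
qed

text \<open>By \<open>K ** J = 0\<close> every surviving word in \<open>J\<close> and
  \<open>K\<close> has its \<open>J\<close> factors in front, which suggests the series of the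
  \<open>J ^^^ k ** G ^^^ (k + 1)\<close>; nilpotency cuts it off after \<open>r\<close>. The second
  claim supplies the idempotent, from which \<open>N\<^sup>\<pi>\<close> is later computed.\<close>

lemma drazin_add_nilpotent:
  assumes KJ: "K ** J = 0" and nil: "J ^^^ Suc r = 0"
    and G: "K ** G = G ** K" "G ** K ** G = G" "K ^^^ l = K ^^^ (l + 1) ** G"
  shows "(J + K)\<^sup>d = G + (\<Sum>k\<in>{1..r}. J ^^^ k ** G ^^^ (k + 1))" (is "_ = ?Y")
    and "(J + K) ** (J + K)\<^sup>d = K ** G + (\<Sum>k\<in>{1..r}. J ^^^ k ** G ^^^ k)"
proof -
  define h where "h k = J ^^^ k ** G ^^^ k" for k
  define H where "H = (\<Sum>k\<in>{1..r}. h k)"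
  have KGG: "K ** (G ** G) = G"
    using G(1,2) by (simp add: matrix_mul_assoc)
  have GJ: "G ** J = 0"
    by (metis G(1,2) KJ matrix_mul_assoc matrix_mul_rzero)
  have h_Suc: "h (Suc k) = J ** h k ** G" for k
    unfolding h_def mat_pow_Suc_right[of G] by (simp add: matrix_mul_assoc)
  have H_eq: "H = (\<Sum>k<r. h (Suc k))"
    unfolding H_def One_nat_def sum.atLeast1_atMost_eq ..
  \<comment> \<open>An index shift again: the new top term contains
    \<open>J ^^^ Suc r = 0\<close>.\<close>
  have "J ** G + J ** H ** G = (\<Sum>k<Suc r. h (Suc k))"
    unfolding sum.lessThan_Suc_shift H_eq
    by (simp add: h_Suc[of "Suc _"] matrix_sum_ldistrib matrix_sum_rdistrib) (simp add: h_def)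
  also have "\<dots> = H"
    using nil by (simp add: H_eq h_def matrix_mul_lzero del: mat_pow.simps)
  finally have JH: "J ** G + J ** (H ** G) = H"
    by (simp add: matrix_mul_assoc)
  have KH: "K ** H = 0"
    unfolding H_eq h_Suc
    by (simp add: matrix_sum_ldistrib matrix_mul_assoc KJ matrix_mul_lzero)
  have GH: "G ** H = 0"
    by (metis G(1,2) KH matrix_mul_assoc matrix_mul_rzero)
  have HGK: "H ** (K ** G) = H"
    unfolding H_eq h_Suc matrix_sum_rdistrib by (simp add: matrix_mul_assoc[symmetric] G(1)[symmetric, THEN matrix_mul_left_cong] KGG)
  have HH: "H ** H = 0"
    by (metis HGK G(1) KH matrix_mul_assoc matrix_mul_rzero)
  note all_rules = KJ GJ KH GH HGK HH KGG G(1)[symmetric]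
  note rules = all_rules all_rules[THEN matrix_mul_left_cong] matrix_ring_simps
  define Y where "Y = G + H ** G"
  have "(J + K) ** Y = (J ** G + J ** (H ** G)) + K ** G"
    by (simp add: Y_def rules)
  then have NY: "(J + K) ** Y = K ** G + H"
    unfolding JH by simp
  have YN: "Y ** (J + K) = K ** G + H"
    by (simp add: Y_def rules)
  have YNY: "Y ** (J + K) ** Y = Y"
    unfolding YN by (simp add: Y_def rules)
  define W where "W = mat 1 - (K ** G + H)"
  \<comment> \<open>The successor guarantees a factor \<open>K\<close> next to \<open>H\<close>, so
    that \<open>K ** H = 0\<close> applies even when \<open>l = 0\<close>.\<close>
  have KW: "K ^^^ Suc j ** W = 0" if "l \<le> j" for j
  proof -
    have "K ^^^ Suc j = K ^^^ (Suc j - l) ** K ^^^ l"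
      using that by (simp del: mat_pow.simps flip: mat_pow_add)
    also have "\<dots> = K ^^^ (Suc j - l) ** (K ^^^ (l + 1) ** G)"
      by (metis G(3))
    also have "\<dots> = K ^^^ Suc j ** K ** G"
      using that by (simp add: matrix_mul_assoc flip: mat_pow_Suc_right mat_pow_add del: mat_pow.simps)
    finally have "K ^^^ Suc j ** (K ** G) = K ^^^ Suc j"
      by (simp add: matrix_mul_assoc)
    moreover have "K ^^^ Suc j ** H = 0"
      by (simp only: mat_pow_Suc_right matrix_mul_assoc[symmetric] KH matrix_mul_rzero)
    ultimately show ?thesis
      by (simp add: W_def matrix_diff_ldistrib matrix_add_ldistrib del: mat_pow.simps)
  qed
  have KN: "K ** (J + K) ^^^ j = K ^^^ Suc j" for j
  proof (induction j)
    case (Suc j)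
    have "K ** (J + K) ^^^ Suc j = K ** K ** (J + K) ^^^ j"
      by (simp add: matrix_mul_assoc matrix_add_ldistrib KJ)
    then show ?case
      using Suc by (simp add: matrix_mul_assoc[symmetric])
  qed simp
  have NW: "(J + K) ^^^ (Suc l + j) ** W = J ^^^ j ** ((J + K) ^^^ Suc l ** W)" for j
  proof (induction j)
    case (Suc j)
    have "(J + K) ^^^ (Suc l + Suc j) ** W
        = J ** ((J + K) ^^^ (Suc l + j) ** W) + (K ** (J + K) ^^^ (Suc l + j)) ** W"
      by (simp only: add_Suc_right mat_pow.simps(2) matrix_add_rdistrib matrix_mul_assoc)
    also have "(K ** (J + K) ^^^ (Suc l + j)) ** W = 0"
      unfolding KN by (rule KW) simp
    finally show ?case
      unfolding Suc by (simp add: matrix_mul_assoc)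
  qed simp
  \<comment> \<open>After \<open>Suc l\<close> factors every further \<open>K\<close> is annihilated
    on \<open>W\<close>, so the other \<open>Suc r\<close> factors contribute only
    \<open>J ^^^ Suc r = 0\<close>.\<close>
  let ?n = "Suc l + Suc r"
  have "(J + K) ^^^ ?n ** W = 0"
    unfolding NW nil by (rule matrix_mul_lzero)
  then have "(J + K) ^^^ ?n = (J + K) ^^^ (?n + 1) ** Y"
    unfolding W_def NY[symmetric] mat_pow_mul_compl by (rule eq_iff_diff_eq_0[THEN iffD2])
  then have "(J + K)\<^sup>d = Y"
    by (rule drazin_eqI[rotated 2]) (simp_all only: NY YN YNY[unfolded YN])
  moreover have "Y = ?Y"
    unfolding Y_def H_def h_def matrix_sum_rdistrib
    by (simp only: Suc_eq_plus1[symmetric] mat_pow_Suc_right[of G] matrix_mul_assoc)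
  ultimately show "(J + K)\<^sup>d = ?Y" "(J + K) ** (J + K)\<^sup>d = K ** G + (\<Sum>k\<in>{1..r}. J ^^^ k ** G ^^^ k)"
    using NY by (simp_all add: H_def h_def)
qed

section \<open>Block matrices\<close>

lemma block_mult:
  "block P Q R T ** block P' Q' R' T' =
    block (P ** P' + Q ** R') (P ** Q' + Q ** T') (R ** P' + T ** R') (R ** Q' + T ** T')"
  by (simp add: block_def matrix_matrix_mult_def vec_eq_iff sum.Plus split: sum.split flip: UNIV_Plus_UNIV)

lemma block_add: "block P Q R T + block P' Q' R' T' = block (P + P') (Q + Q') (R + R') (T + T')"
  by (simp add: block_def vec_eq_iff split: sum.split)

lemma block_diff: "block P Q R T - block P' Q' R' T' = block (P - P') (Q - Q') (R - R') (T - T')"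
  by (simp add: block_def vec_eq_iff split: sum.split)

lemma mat_1_block: "mat 1 = block (mat 1) 0 0 (mat 1)"
  by (simp add: block_def mat_def vec_eq_iff split: sum.split)

lemma zero_block: "0 = block 0 0 0 0"
  by (simp add: block_def vec_eq_iff split: sum.split)

lemma block_eq_iff:
  "block P Q R T = block P' Q' R' T' \<longleftrightarrow> P = P' \<and> Q = Q' \<and> R = R' \<and> T = T'"
proof
  assume eq: "block P Q R T = block P' Q' R' T'"
  have "block P Q R T $ i $ j = block P' Q' R' T' $ i $ j" for i j
    by (simp add: eq)
  from this[of "Inl _" "Inl _"] this[of "Inl _" "Inr _"] this[of "Inr _" "Inl _"] this[of "Inr _" "Inr _"]
  show "P = P' \<and> Q = Q' \<and> R = R' \<and> T = T'"
    by (simp add: block_def vec_eq_iff)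
qed simp

lemma block_exhaust:
  obtains P Q R T where "X = block P Q R T"
proof
  show "X = block (\<chi> i j. X $ Inl i $ Inl j) (\<chi> i j. X $ Inl i $ Inr j)
    (\<chi> i j. X $ Inr i $ Inl j) (\<chi> i j. X $ Inr i $ Inr j)"
    by (simp add: block_def vec_eq_iff split: sum.split)
qed

lemma mat_pow_block_diag: "block P 0 0 T ^^^ k = block (P ^^^ k) 0 0 (T ^^^ k)"
  by (induction k) (simp_all add: mat_1_block block_mult matrix_mul_lzero matrix_mul_rzero)

section \<open>Comparing \<open>U ** V\<close> with \<open>V ** U\<close>\<close>

lemma mat_pow_double: "X ^^^ (2 * k) = (X ** X) ^^^ k"
  by (induction k) (simp_all add: matrix_mul_assoc)

lemma mat_pow_Suc_swap: "(V ** U) ^^^ Suc k = V ** (U ** V) ^^^ k ** U"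
  by (induction k) (simp_all add: matrix_mul_assoc)

context
  fixes U :: "complex^'m^'n" and V :: "complex^'n^'m" and X :: "complex^'n^'n"
  defines "X \<equiv> (U ** V)\<^sup>d"
begin

text \<open>A rewrite system for words nested to the right: \<open>X\<close> moves right past
  \<open>U\<close> and \<open>V\<close>, and \<open>U ** V\<close> is absorbed by a double
  \<open>X\<close>.\<close>

lemma UV_drazin_rules:
  shows "X ** (U ** V) = U ** (V ** X)" "U ** (V ** (X ** X)) = X"
    "X ** (U ** (V ** W)) = U ** (V ** (X ** W))" "U ** (V ** (X ** (X ** W'))) = X ** W'"
proof -
  show "X ** (U ** V) = U ** (V ** X)" "U ** (V ** (X ** X)) = X"
    using drazin_commute[of "U ** V"] drazin_outer[of "U ** V"]
    by (simp_all add: X_def matrix_mul_assoc)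
  then show "X ** (U ** (V ** W)) = U ** (V ** (X ** W))" "U ** (V ** (X ** (X ** W'))) = X ** W'"
    by (simp_all add: matrix_mul_assoc)
qed

lemma UV_index:
  obtains k where "(U ** V) ^^^ k = (U ** V) ^^^ k ** U ** V ** X"
  using drazin_index[of "U ** V"]
  by (simp add: X_def mat_pow_Suc_right matrix_mul_assoc del: mat_pow.simps)

text \<open>Cline's formula. Sandwiching between \<open>V\<close> and \<open>U\<close> carries an
  exponent \<open>k\<close> for \<open>U ** V\<close> to the exponent \<open>Suc k\<close> for
  \<open>V ** U\<close>.\<close>

lemma drazin_Cline: "(V ** U)\<^sup>d = V ** X ** X ** U"
proof -
  obtain k where k: "(U ** V) ^^^ k = (U ** V) ^^^ k ** U ** V ** X"
    by (rule UV_index)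
  have "(V ** U) ^^^ Suc k = V ** ((U ** V) ^^^ k ** U ** V ** X) ** U"
    by (simp only: mat_pow_Suc_swap k[symmetric])
  also have "\<dots> = (V ** U) ^^^ (Suc k + 1) ** (V ** X ** X ** U)"
    unfolding Suc_eq_plus1[symmetric] mat_pow_Suc_right[of _ "Suc k"]
    by (simp add: mat_pow_Suc_swap matrix_mul_assoc[symmetric] UV_drazin_rules del: mat_pow.simps)
  finally show ?thesis
    by (rule drazin_eqI[rotated 2]) (simp_all add: matrix_mul_assoc[symmetric] UV_drazin_rules)
qed

text \<open>\<open>K ** K\<close> is block diagonal with blocks \<open>U ** V\<close> and
  \<open>V ** U\<close>, and \<open>G\<close> is \<open>K ** (K ** K)\<^sup>d\<close> simplified by
  Cline's formula. An even power of \<open>K\<close> therefore provides the exponent.\<close>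

lemma drazin_antidiagonal:
  defines "K \<equiv> block 0 U V 0" and "G \<equiv> block 0 (X ** U) (V ** X) 0"
  shows "K ** G = block (U ** V)\<^sup>e 0 0 (V ** U)\<^sup>e" "K ** G = G ** K" "G ** K ** G = G"
    "\<exists>l. K ^^^ l = K ^^^ (l + 1) ** G"
proof -
  have e: "(U ** V)\<^sup>e = U ** V ** X" "(V ** U)\<^sup>e = V ** X ** U"
    by (simp_all add: drazin_idem_def drazin_Cline X_def[symmetric])
      (simp add: matrix_mul_assoc[symmetric] UV_drazin_rules)
  show KG: "K ** G = block (U ** V)\<^sup>e 0 0 (V ** U)\<^sup>e"
    by (simp add: K_def G_def e block_mult matrix_mul_lzero matrix_mul_rzero matrix_mul_assoc)
  show "K ** G = G ** K" "G ** K ** G = G"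
    by (simp_all add: K_def G_def block_mult matrix_ring_simps UV_drazin_rules)
  obtain k where k: "(U ** V) ^^^ k = (U ** V) ^^^ k ** U ** V ** X"
    by (rule UV_index)
  have "(U ** V) ^^^ Suc k ** (U ** V ** X) = U ** V ** ((U ** V) ^^^ k ** U ** V ** X)"
    by (simp add: matrix_mul_assoc)
  then have 1: "(U ** V) ^^^ Suc k ** (U ** V ** X) = (U ** V) ^^^ Suc k"
    by (simp only: k[symmetric] mat_pow.simps)
  have "(V ** U) ^^^ Suc k ** (V ** X ** U) = V ** ((U ** V) ^^^ k ** U ** V ** X) ** U"
    by (simp add: mat_pow_Suc_swap matrix_mul_assoc del: mat_pow.simps)
  then have 2: "(V ** U) ^^^ Suc k ** (V ** X ** U) = (V ** U) ^^^ Suc k"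
    by (simp only: k[symmetric] mat_pow_Suc_swap)
  have "K ** K = block (U ** V) 0 0 (V ** U)"
    by (simp add: K_def block_mult matrix_mul_lzero matrix_mul_rzero)
  then have "K ^^^ (2 * Suc k) = block ((U ** V) ^^^ Suc k) 0 0 ((V ** U) ^^^ Suc k)"
    by (simp only: mat_pow_double mat_pow_block_diag)
  then have "K ^^^ (2 * Suc k) ** (K ** G) = K ^^^ (2 * Suc k)"
    by (simp add: KG e block_mult matrix_mul_lzero matrix_mul_rzero 1 2 del: mat_pow.simps)
  then have "K ^^^ (2 * Suc k) = K ^^^ (2 * Suc k + 1) ** G"
    by (metis Suc_eq_plus1 mat_pow_Suc_right matrix_mul_assoc)
  then show "\<exists>l. K ^^^ l = K ^^^ (l + 1) ** G" ..
qed

end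

section \<open>Inverses in corners\<close>

lemma drazin_idem_rules:
  "A ** A\<^sup>d = A\<^sup>e" "A\<^sup>d ** A = A\<^sup>e" "A\<^sup>e ** A\<^sup>d = A\<^sup>d" "A\<^sup>d ** A\<^sup>e = A\<^sup>d"
  "A\<^sup>e ** A\<^sup>e = A\<^sup>e" "A\<^sup>e ** A = A ** A\<^sup>e"
  unfolding drazin_idem_def
  using drazin_commute[of A] drazin_outer[of A] by (metis matrix_mul_assoc)+

lemma drazin_compl_rules:
  "A\<^sup>\<pi> ** A\<^sup>\<pi> = A\<^sup>\<pi>" "A\<^sup>\<pi> ** A = A ** A\<^sup>\<pi>" "A\<^sup>e ** A\<^sup>\<pi> = 0" "A\<^sup>\<pi> ** A\<^sup>e = 0"
  by (simp_all add: drazin_compl_def matrix_ring_simps drazin_idem_rules)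

lemma mat_pow_drazin_compl: "mat_index A \<le> k \<Longrightarrow> A ^^^ k ** A\<^sup>\<pi> = 0"
proof -
  assume "mat_index A \<le> k"
  then have "A ^^^ k ** A\<^sup>\<pi> = A ^^^ (k - mat_index A) ** (A ^^^ mat_index A ** (mat 1 - A ** A\<^sup>d))"
    by (simp add: drazin_compl_def drazin_idem_def matrix_mul_assoc flip: mat_pow_add)
  also have "\<dots> = 0"
    unfolding mat_pow_mul_compl drazin_index[symmetric] by (simp add: matrix_mul_rzero)
  finally show ?thesis .
qed

lemma mat_pow_mul_idem:
  assumes "p ** p = p" "p ** A = A ** p" "0 < k"
  shows "(A ** p) ^^^ k = A ^^^ k ** p"
  using assms(3)
proof (induction k rule: nat_induct_non_zero)
  case (Suc k)
  have "(A ** p) ^^^ Suc k = A ** (p ** A ^^^ k) ** p"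
    by (simp add: Suc matrix_mul_assoc)
  also have "p ** A ^^^ k = A ^^^ k ** p"
    using assms(2) by (metis mat_pow_commute)
  finally show ?case
    by (simp add: matrix_mul_assoc[symmetric] assms(1))
qed simp

section \<open>Group inverses and units of corner rings\<close>

lemma group_inverse_unique: "is_group_inverse X Y \<Longrightarrow> is_group_inverse X Z \<Longrightarrow> Y = Z"
  unfolding is_group_inverse_def by (metis matrix_mul_assoc)

lemma is_group_inverse_group_inv: "group_invertible X \<Longrightarrow> is_group_inverse X X\<^sup>#"
  unfolding group_invertible_def group_inv_def using group_inverse_unique by (metis theI)

lemma drazin_eq_group_inv: "group_invertible X \<Longrightarrow> X\<^sup>d = X\<^sup>#"
  using is_group_inverse_group_inv[of X] unfolding is_group_inverse_def
  by (intro drazin_eqI[of X _ 1]) (auto simp: matrix_mul_assoc[symmetric])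

lemma corner_inverse_imp_group_inv:
  assumes "corner_inverse e x y"
  shows "group_invertible x" "x\<^sup># = y"
proof -
  have "is_group_inverse x y"
    using assms by (simp add: corner_inverse_def is_group_inverse_def)
  then show "group_invertible x" "x\<^sup># = y"
    using is_group_inverse_group_inv group_inverse_unique group_invertible_def by blast+
qed

lemma corner_inverse_group_inv:
  assumes "group_invertible x" "x ** x\<^sup># = e"
  shows "corner_inverse e x x\<^sup>#"
  using is_group_inverse_group_inv[OF assms(1)] assms(2)
  by (auto simp: corner_inverse_def is_group_inverse_def) (metis matrix_mul_assoc)+

lemma corner_inverse_of_drazin_idem:
  assumes "group_invertible x" "x\<^sup>e = e"
  shows "corner_inverse e x x\<^sup>#"
  using assms by (intro corner_inverse_group_inv) (simp_all add: drazin_idem_def drazin_eq_group_inv)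

text \<open>Relative to \<open>e\<close>, the last hypothesis says that the lower block row of
  \<open>Y\<close> is (0, 1). The inverse then has the same shape, so its corner inverts the corner
  of \<open>Y\<close>. Every invertibility condition of the theorem has this form.\<close>

lemma corner_inverse_of_invertible:
  assumes e: "e ** e = e" and "invertible Y" and Y: "(mat 1 - e) ** Y = mat 1 - e"
  shows "\<exists>y. corner_inverse e (e ** Y ** e) y"
proof -
  obtain X where X: "Y ** X = mat 1" "X ** Y = mat 1"
    using assms(2) unfolding invertible_def by blast
  have eY: "e ** (Y ** e) = Y ** e"
  proof -
    have "(mat 1 - e) ** (Y ** e) = 0"
      by (simp add: matrix_mul_assoc Y) (simp add: matrix_ring_simps e)
    then show ?thesis
      by (simp add: matrix_ring_simps)
  qed
  have "mat 1 - e = (mat 1 - e) ** X"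
    by (metis X(1) Y matrix_mul_assoc matrix_mul_rid)
  then have "(mat 1 - e) ** (X ** e) = 0"
    by (simp add: matrix_mul_assoc) (metis e cancel_comm_monoid_add_class.diff_cancel matrix_diff_rdistrib matrix_mul_lid)
  then have eX: "e ** (X ** e) = X ** e"
    by (simp add: matrix_ring_simps)
  have "corner_inverse e (e ** Y ** e) (e ** X ** e)"
    by (simp add: corner_inverse_def matrix_mul_assoc[symmetric] eY eX e e[THEN matrix_mul_left_cong])
      (metis X e matrix_mul_assoc matrix_mul_lid eX eY)
  then show ?thesis ..
qed

text \<open>The Banachiewicz formula inside corners, with \<open>D\<^sup>d\<close> in place of the
  inverse of \<open>D\<close>. The other claims identify \<open>\<zeta>\<close> as the inverse of
  the second Schur complement, giving the passage between \<open>s\<close> and \<open>z\<close> and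
  the two forms of the group inverse.\<close>

lemma corner_inverse_schur:
  fixes A :: "complex^'n^'n" and B :: "complex^'n^'m"
    and C :: "complex^'m^'n" and D :: "complex^'m^'m"
  defines "E \<equiv> block A\<^sup>e 0 0 D\<^sup>e"
  assumes corner: "corner_inverse A\<^sup>e (A\<^sup>e ** (A - C ** D\<^sup>d ** B) ** A\<^sup>e) \<sigma>"
  defines "\<zeta> \<equiv> D\<^sup>d ** B ** \<sigma> ** C ** D\<^sup>d + D\<^sup>d"
  shows "corner_inverse E (E ** block A C B D ** E)
      (block \<sigma> (- (\<sigma> ** C ** D\<^sup>d)) (- (D\<^sup>d ** B ** \<sigma>)) \<zeta>)"
    and "corner_inverse D\<^sup>e (D\<^sup>e ** (D - B ** A\<^sup>d ** C) ** D\<^sup>e) \<zeta>"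
    and "\<sigma> = A\<^sup>d + A\<^sup>d ** C ** \<zeta> ** B ** A\<^sup>d"
    and "\<sigma> ** C ** D\<^sup>d = A\<^sup>d ** C ** \<zeta>"
    and "D\<^sup>d ** B ** \<sigma> = \<zeta> ** B ** A\<^sup>d"
proof -
  have e: "A\<^sup>e ** \<sigma> = \<sigma>" "\<sigma> ** A\<^sup>e = \<sigma>"
    and s: "A\<^sup>e ** (A - C ** D\<^sup>d ** B) ** A\<^sup>e ** \<sigma> = A\<^sup>e" "\<sigma> ** (A\<^sup>e ** (A - C ** D\<^sup>d ** B) ** A\<^sup>e) = A\<^sup>e"
    using corner by (auto simp: corner_inverse_def)
  note A = drazin_idem_rules[of A] and D = drazin_idem_rules[of D]
  have \<sigma>A: "\<sigma> ** (A ** A\<^sup>e) = \<sigma> ** A" "A\<^sup>e ** (A ** \<sigma>) = A ** \<sigma>"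
    using e A by (metis matrix_mul_assoc)+
  \<comment> \<open>The two equations defining the inverse are solved for the products containing
    \<open>C ** D\<^sup>d ** B\<close> next to \<open>\<sigma>\<close>. Used as rewrite rules, they
    eliminate every such product.\<close>
  have "\<sigma> ** A - \<sigma> ** (C ** (D\<^sup>d ** (B ** A\<^sup>e))) = A\<^sup>e"
    using s(2) by (simp add: matrix_ring_simps \<sigma>A e e[THEN matrix_mul_left_cong])
  then have \<sigma>e: "\<sigma> ** (C ** (D\<^sup>d ** (B ** A\<^sup>e))) = \<sigma> ** A - A\<^sup>e"
    by (simp add: algebra_simps)
  have "A ** \<sigma> - A\<^sup>e ** (C ** (D\<^sup>d ** (B ** \<sigma>))) = A\<^sup>e"
    using s(1) by (simp add: matrix_ring_simps \<sigma>A e e[THEN matrix_mul_left_cong])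
  then have e\<sigma>: "A\<^sup>e ** (C ** (D\<^sup>d ** (B ** \<sigma>))) = A ** \<sigma> - A\<^sup>e"
    by (simp add: algebra_simps)
  have "\<sigma> ** (C ** (D\<^sup>d ** (B ** A\<^sup>d))) = \<sigma> ** (C ** (D\<^sup>d ** (B ** A\<^sup>e))) ** A\<^sup>d"
    by (simp add: matrix_mul_assoc[symmetric] A)
  then have \<sigma>d: "\<sigma> ** (C ** (D\<^sup>d ** (B ** A\<^sup>d))) = \<sigma> - A\<^sup>d"
    unfolding \<sigma>e by (simp add: matrix_ring_simps A e)
  have "A\<^sup>d ** (C ** (D\<^sup>d ** (B ** \<sigma>))) = A\<^sup>d ** (A\<^sup>e ** (C ** (D\<^sup>d ** (B ** \<sigma>))))"
    by (simp add: matrix_mul_assoc A)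
  then have d\<sigma>: "A\<^sup>d ** (C ** (D\<^sup>d ** (B ** \<sigma>))) = \<sigma> - A\<^sup>d"
    unfolding e\<sigma> by (simp add: matrix_ring_simps A A[THEN matrix_mul_left_cong] e)
  note eqs = A D e \<sigma>A \<sigma>e e\<sigma> \<sigma>d d\<sigma>
  have "\<sigma> ** (C ** (D\<^sup>d ** (B ** (A\<^sup>e ** W)))) = \<sigma> ** (A ** W) - A\<^sup>e ** W"
    "A\<^sup>e ** (C ** (D\<^sup>d ** (B ** (\<sigma> ** W)))) = A ** (\<sigma> ** W) - A\<^sup>e ** W"
    "\<sigma> ** (C ** (D\<^sup>d ** (B ** (A\<^sup>d ** W)))) = \<sigma> ** W - A\<^sup>d ** W"
    "A\<^sup>d ** (C ** (D\<^sup>d ** (B ** (\<sigma> ** W)))) = \<sigma> ** W - A\<^sup>d ** W" for W :: "complex^'m^'n"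
    using \<sigma>e e\<sigma> \<sigma>d d\<sigma> by (metis matrix_mul_assoc matrix_diff_rdistrib)+
  note rules = eqs this A[THEN matrix_mul_left_cong] D[THEN matrix_mul_left_cong]
    e[THEN matrix_mul_left_cong] matrix_ring_simps
  show "corner_inverse E (E ** block A C B D ** E)
      (block \<sigma> (- (\<sigma> ** C ** D\<^sup>d)) (- (D\<^sup>d ** B ** \<sigma>)) \<zeta>)"
    unfolding corner_inverse_def E_def \<zeta>_def block_mult block_eq_iff
    by (simp add: rules)
  show "corner_inverse D\<^sup>e (D\<^sup>e ** (D - B ** A\<^sup>d ** C) ** D\<^sup>e) \<zeta>"
    unfolding corner_inverse_def \<zeta>_def by (simp add: rules)
  show "\<sigma> = A\<^sup>d + A\<^sup>d ** C ** \<zeta> ** B ** A\<^sup>d"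
    "\<sigma> ** C ** D\<^sup>d = A\<^sup>d ** C ** \<zeta>" "D\<^sup>d ** B ** \<sigma> = \<zeta> ** B ** A\<^sup>d"
    unfolding \<zeta>_def by (simp_all add: rules)
qed

text \<open>Conversely, the upper left block of \<open>Q\<close> inverts the Schur complement: the
  zero off-diagonal blocks of the two products express \<open>V\<close> and \<open>U\<close> through
  \<open>\<sigma>\<close>, and substitution into the upper left blocks leaves the claim.\<close>

lemma corner_inverse_schur_block:
  fixes A :: "complex^'n^'n" and B :: "complex^'n^'m"
    and C :: "complex^'m^'n" and D :: "complex^'m^'m"
  defines "E \<equiv> block A\<^sup>e 0 0 D\<^sup>e"
  assumes "corner_inverse E (E ** block A C B D ** E) Q"
  shows "\<exists>\<sigma>. corner_inverse A\<^sup>e (A\<^sup>e ** (A - C ** D\<^sup>d ** B) ** A\<^sup>e) \<sigma>"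
proof -
  obtain \<sigma> V U T where Q: "Q = block \<sigma> V U T"
    by (rule block_exhaust)
  note A = drazin_idem_rules[of A] and D = drazin_idem_rules[of D]
  have q: "A\<^sup>e ** \<sigma> = \<sigma>" "\<sigma> ** A\<^sup>e = \<sigma>" "V ** D\<^sup>e = V" "D\<^sup>e ** U = U"
    and L: "\<sigma> ** (A\<^sup>e ** A ** A\<^sup>e) + V ** (D\<^sup>e ** B ** A\<^sup>e) = A\<^sup>e"
      "\<sigma> ** (A\<^sup>e ** C ** D\<^sup>e) + V ** (D\<^sup>e ** D ** D\<^sup>e) = 0"
    and R: "A\<^sup>e ** A ** A\<^sup>e ** \<sigma> + A\<^sup>e ** C ** D\<^sup>e ** U = A\<^sup>e"
      "D\<^sup>e ** B ** A\<^sup>e ** \<sigma> + D\<^sup>e ** D ** D\<^sup>e ** U = 0"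
    using assms(2) unfolding corner_inverse_def E_def Q block_mult block_eq_iff
    by (auto simp: matrix_mul_lzero matrix_mul_rzero)
  have "(\<sigma> ** (A\<^sup>e ** C ** D\<^sup>e) + V ** (D\<^sup>e ** D ** D\<^sup>e)) ** D\<^sup>d = \<sigma> ** (C ** D\<^sup>d) + V"
    by (simp add: matrix_ring_simps D q q[THEN matrix_mul_left_cong])
  then have V: "V = - (\<sigma> ** (C ** D\<^sup>d))"
    unfolding L by (simp add: matrix_mul_lzero eq_neg_iff_add_eq_0 add.commute)
  have "D\<^sup>d ** (D\<^sup>e ** B ** A\<^sup>e ** \<sigma> + D\<^sup>e ** D ** D\<^sup>e ** U) = D\<^sup>d ** (B ** \<sigma>) + U"
    by (simp add: matrix_ring_simps D D[THEN matrix_mul_left_cong] q)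
  then have U: "U = - (D\<^sup>d ** (B ** \<sigma>))"
    unfolding R by (simp add: matrix_mul_rzero eq_neg_iff_add_eq_0 add.commute)
  have "corner_inverse A\<^sup>e (A\<^sup>e ** (A - C ** D\<^sup>d ** B) ** A\<^sup>e) \<sigma>"
    using L(1) R(1) unfolding corner_inverse_def U V
    by (simp add: matrix_ring_simps A D A[THEN matrix_mul_left_cong] D[THEN matrix_mul_left_cong]
        q q[THEN matrix_mul_left_cong])
  then show ?thesis ..
qed

text \<open>\<open>A\<^sup>d\<close> is a unit of the corner, with inverse
  \<open>A ** A\<^sup>e\<close>, so it can be cancelled as a factor.\<close>

lemma corner_inverse_cancel_left:
  assumes "corner_inverse A\<^sup>e (A\<^sup>d ** s) y" "s = A\<^sup>e ** S ** A\<^sup>e"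
  shows "corner_inverse A\<^sup>e s (y ** A\<^sup>d)"
proof -
  note A = drazin_idem_rules[of A]
  have y: "A\<^sup>e ** y = y" "y ** A\<^sup>e = y" "A\<^sup>d ** s ** y = A\<^sup>e" "y ** (A\<^sup>d ** s) = A\<^sup>e"
    using assms(1) by (auto simp: corner_inverse_def)
  have s: "A\<^sup>e ** s = s" "s ** A\<^sup>e = s"
    by (simp_all add: assms(2) matrix_mul_assoc A) (simp add: matrix_mul_assoc[symmetric] A)
  have "s ** (y ** A\<^sup>d) = A ** (A\<^sup>d ** s ** y) ** A\<^sup>d"
    by (simp add: matrix_mul_assoc A s)
  also have "\<dots> = A\<^sup>e"
    unfolding y(3) by (simp add: matrix_mul_assoc[symmetric] A)
  finally show ?thesis
    using y s by (simp add: corner_inverse_def matrix_mul_assoc A) (simp add: matrix_mul_assoc[symmetric] A)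
qed

text \<open>Inside the corner \<open>A\<^sup>d ** s ** A\<close> is a conjugate of \<open>s\<close>,
  so its inverse is conjugated back.\<close>

lemma corner_inverse_cancel_conj:
  assumes "corner_inverse A\<^sup>e (A\<^sup>d ** s ** A) y" "s = A\<^sup>e ** S ** A\<^sup>e"
  shows "corner_inverse A\<^sup>e s (A ** y ** A\<^sup>d)"
proof -
  note A = drazin_idem_rules[of A]
  have y: "A\<^sup>e ** y = y" "y ** A\<^sup>e = y" "A\<^sup>d ** s ** A ** y = A\<^sup>e" "y ** (A\<^sup>d ** s ** A) = A\<^sup>e"
    using assms(1) by (auto simp: corner_inverse_def)
  have s: "A\<^sup>e ** s = s" "s ** A\<^sup>e = s"
    by (simp_all add: assms(2) matrix_mul_assoc A) (simp add: matrix_mul_assoc[symmetric] A)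
  have "s ** (A ** y ** A\<^sup>d) = A ** (A\<^sup>d ** s ** A ** y) ** A\<^sup>d"
    by (simp add: matrix_mul_assoc A s)
  also have "\<dots> = A\<^sup>e"
    unfolding y(3) by (simp add: matrix_mul_assoc[symmetric] A)
  finally have 1: "s ** (A ** y ** A\<^sup>d) = A\<^sup>e" .
  have "A ** y ** A\<^sup>d ** s = A ** (y ** (A\<^sup>d ** s ** A)) ** A\<^sup>d"
    by (simp add: matrix_mul_assoc[symmetric] A s)
  also have "\<dots> = A\<^sup>e"
    unfolding y(4) by (simp add: matrix_mul_assoc[symmetric] A)
  finally have 2: "A ** y ** A\<^sup>d ** s = A\<^sup>e" .
  have "A\<^sup>e ** (A ** y ** A\<^sup>d) = A ** y ** A\<^sup>d"
    by (metis A(6) y(1) matrix_mul_assoc)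
  moreover have "A ** y ** A\<^sup>d ** A\<^sup>e = A ** y ** A\<^sup>d"
    by (metis A(4) matrix_mul_assoc)
  ultimately show ?thesis
    using s 1 2 by (simp add: corner_inverse_def)
qed

lemma ex_corner_inverse:
  fixes A S :: "complex^'n^'n"
  defines "s \<equiv> A\<^sup>e ** S ** A\<^sup>e"
  assumes "(group_invertible s \<and> s\<^sup>e = A\<^sup>e) \<or> invertible (A\<^sup>\<pi> + s)
    \<or> invertible (mat 1 + A\<^sup>d ** (s - A)) \<or> invertible (mat 1 + A\<^sup>d ** (S - mat 1) ** A)"
  shows "\<exists>y. corner_inverse A\<^sup>e s y"
proof -
  note A = drazin_idem_rules[of A]
  have s: "A\<^sup>e ** s = s" "s ** A\<^sup>e = s"
    by (simp_all add: s_def matrix_mul_assoc A) (simp add: matrix_mul_assoc[symmetric] A)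
  note rules = matrix_ring_simps drazin_compl_def A A[THEN matrix_mul_left_cong] s s[THEN matrix_mul_left_cong]
  consider "group_invertible s \<and> s\<^sup>e = A\<^sup>e" | "invertible (A\<^sup>\<pi> + s)"
    | "invertible (mat 1 + A\<^sup>d ** (s - A))" | "invertible (mat 1 + A\<^sup>d ** (S - mat 1) ** A)"
    using assms(2) by blast
  then show ?thesis
  proof cases
    case 1
    then show ?thesis
      using corner_inverse_of_drazin_idem by blast
  next
    case 2
    then show ?thesis
      using corner_inverse_of_invertible[OF A(5), of "A\<^sup>\<pi> + s"] by (simp add: rules)
  next
    case 3
    then have "\<exists>y. corner_inverse A\<^sup>e (A\<^sup>d ** s) y"
      using corner_inverse_of_invertible[OF A(5), of "mat 1 + A\<^sup>d ** (s - A)"] by (simp add: rules)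
    then show ?thesis
      using corner_inverse_cancel_left s_def by blast
  next
    case 4
    have "A\<^sup>d ** (S ** (A\<^sup>e ** A)) = A\<^sup>d ** s ** A"
      by (simp only: s_def matrix_mul_assoc A(4))
    then have "A\<^sup>d ** (S ** (A ** A\<^sup>e)) = A\<^sup>d ** (s ** A)"
      by (simp add: matrix_mul_assoc[symmetric] A)
    with 4 have "\<exists>y. corner_inverse A\<^sup>e (A\<^sup>d ** s ** A) y"
      using corner_inverse_of_invertible[OF A(5), of "mat 1 + A\<^sup>d ** (S - mat 1) ** A"]
      by (simp add: rules)
    then show ?thesis
      using corner_inverse_cancel_conj s_def by blast
  qed
qed

text \<open>Eliminating \<open>\<zeta>\<close> from the two equations and multiplying by
  \<open>A\<close> on the right gives \<open>s\<^sup># ** A - s\<^sup># ** C ** D\<^sup>d ** B **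
  A\<^sup>e = A\<^sup>e\<close>, whose left side is \<open>s\<^sup># ** s\<close>.\<close>

lemma corner_inverse_of_coupling:
  fixes A :: "complex^'n^'n" and B :: "complex^'n^'m"
    and C :: "complex^'m^'n" and D :: "complex^'m^'m"
  defines "s \<equiv> A\<^sup>e ** (A - C ** D\<^sup>d ** B) ** A\<^sup>e"
  assumes inv: "group_invertible s"
    and eqs: "s\<^sup># = A\<^sup>d ** C ** \<zeta> ** B ** A\<^sup>d + A\<^sup>d" "A\<^sup>d ** C ** \<zeta> = s\<^sup># ** C ** D\<^sup>d"
  shows "corner_inverse A\<^sup>e s s\<^sup>#"
proof -
  note A = drazin_idem_rules[of A]
  have g: "s\<^sup># ** s ** s\<^sup># = s\<^sup>#" "s ** s\<^sup># = s\<^sup># ** s"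
    using is_group_inverse_group_inv[OF inv] by (auto simp: is_group_inverse_def)
  have "s ** A\<^sup>e = s"
    by (simp add: s_def matrix_mul_assoc[symmetric] A)
  then have e: "s\<^sup># ** A\<^sup>e = s\<^sup>#"
    using g by (metis matrix_mul_assoc)
  have "s\<^sup># = s\<^sup># ** C ** D\<^sup>d ** B ** A\<^sup>d + A\<^sup>d"
    using eqs by simp
  then have "s\<^sup># ** A = s\<^sup># ** C ** D\<^sup>d ** B ** A\<^sup>e + A\<^sup>e"
    by (metis A(2) matrix_add_rdistrib matrix_mul_assoc)
  moreover have "s\<^sup># ** (A ** A\<^sup>e) = s\<^sup># ** A"
    using e A(6) by (metis matrix_mul_assoc)
  moreover have "s\<^sup># ** s = s\<^sup># ** (A\<^sup>e ** (A - C ** D\<^sup>d ** B) ** A\<^sup>e)"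
    by (rule arg_cong[where f = "(**) s\<^sup>#"]) (simp only: s_def)
  moreover have "\<dots> = s\<^sup># ** (A ** A\<^sup>e) - s\<^sup># ** C ** D\<^sup>d ** B ** A\<^sup>e"
    by (simp add: matrix_ring_simps e[THEN matrix_mul_left_cong])
  ultimately have "s\<^sup># ** s = A\<^sup>e"
    by simp
  then show ?thesis
    using inv g by (intro corner_inverse_group_inv) simp_all
qed

section \<open>The Drazin inverse of a block matrix\<close>

lemma drazin_compl_mul_idem_eq_0: "X\<^sup>\<pi> ** Y ** Z = 0 \<Longrightarrow> X\<^sup>\<pi> ** Y ** Z\<^sup>e = 0"
  by (simp add: drazin_idem_def matrix_mul_assoc matrix_mul_lzero)

text \<open>Removes the inner projections: \<open>A\<^sup>\<pi> ** C ** D\<^sup>\<pi> ** B\<close>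
  becomes \<open>A\<^sup>\<pi> ** C ** B\<close>, the product that appears in the final
  formula.\<close>

lemma drazin_compl_mul_compl:
  "X\<^sup>\<pi> ** Y ** Z = 0 \<Longrightarrow> X\<^sup>\<pi> ** Y ** Z\<^sup>\<pi> = X\<^sup>\<pi> ** Y"
  using drazin_compl_mul_idem_eq_0[of X Y Z] by (simp add: drazin_compl_def[of Z] matrix_diff_ldistrib)

lemma drazin_complementary_part:
  fixes A :: "complex^'n^'n" and B :: "complex^'n^'m"
    and C :: "complex^'m^'n" and D :: "complex^'m^'m"
  defines "G \<equiv> block 0 ((A\<^sup>\<pi> ** C ** B)\<^sup>d ** A\<^sup>\<pi> ** C) (D\<^sup>\<pi> ** B ** (A\<^sup>\<pi> ** C ** B)\<^sup>d) 0"
    and "N \<equiv> block (A ** A\<^sup>\<pi>) (A\<^sup>\<pi> ** C) (D\<^sup>\<pi> ** B) (D ** D\<^sup>\<pi>)"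
    and "t \<equiv> max (mat_index A) (mat_index D)"
  assumes CD: "A\<^sup>\<pi> ** C ** D = 0" and BA: "D\<^sup>\<pi> ** B ** A = 0"
  shows "N\<^sup>d = G + (\<Sum>k\<in>{1..<t}. block ((A ^^^ k) ** A\<^sup>\<pi>) 0 0 ((D ^^^ k) ** D\<^sup>\<pi>) ** (G ^^^ (k + 1)))"
    and "mat 1 - N ** N\<^sup>d = block (A\<^sup>\<pi> ** C ** B)\<^sup>\<pi> 0 0 (D\<^sup>\<pi> ** B ** C)\<^sup>\<pi>
      - (\<Sum>k\<in>{1..<t}. block ((A ^^^ k) ** A\<^sup>\<pi>) 0 0 ((D ^^^ k) ** D\<^sup>\<pi>) ** (G ^^^ k))"
proof -
  define J where "J = block (A ** A\<^sup>\<pi>) 0 0 (D ** D\<^sup>\<pi>)"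
  define K where "K = block 0 (A\<^sup>\<pi> ** C) (D\<^sup>\<pi> ** B) 0"
  have UV: "A\<^sup>\<pi> ** C ** (D\<^sup>\<pi> ** B) = A\<^sup>\<pi> ** C ** B"
    using drazin_compl_mul_compl[OF CD] by (simp add: matrix_mul_assoc)
  have VU: "D\<^sup>\<pi> ** B ** (A\<^sup>\<pi> ** C) = D\<^sup>\<pi> ** B ** C"
    using drazin_compl_mul_compl[OF BA] by (simp add: matrix_mul_assoc)
  have N: "N = J + K"
    by (simp add: N_def J_def K_def block_add)
  have J_pow: "J ^^^ k = block ((A ^^^ k) ** A\<^sup>\<pi>) 0 0 ((D ^^^ k) ** D\<^sup>\<pi>)" if "0 < k" for k
    using that by (simp add: J_def mat_pow_block_diag mat_pow_mul_idem drazin_compl_rules)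
  have KJ: "K ** J = 0"
    by (simp add: K_def J_def block_mult matrix_mul_lzero matrix_mul_rzero matrix_mul_assoc CD BA flip: zero_block)
  \<comment> \<open>With truncated subtraction the exponent is \<open>t\<close> for positive
    \<open>t\<close> and 1 for \<open>t = 0\<close>; in both cases it is positive, as
    \<open>J_pow\<close> demands, and at least both indices.\<close>
  have nil: "J ^^^ Suc (t - 1) = 0"
    by (subst J_pow) (simp_all add: mat_pow_drazin_compl t_def zero_block del: mat_pow.simps)
  have G_eq: "G = block 0 ((A\<^sup>\<pi> ** C ** (D\<^sup>\<pi> ** B))\<^sup>d ** (A\<^sup>\<pi> ** C)) (D\<^sup>\<pi> ** B ** (A\<^sup>\<pi> ** C ** (D\<^sup>\<pi> ** B))\<^sup>d) 0"
    unfolding UV by (simp only: G_def matrix_mul_assoc)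
  note G = drazin_antidiagonal[of "A\<^sup>\<pi> ** C" "D\<^sup>\<pi> ** B", folded G_eq K_def, unfolded UV VU]
  obtain l where l: "K ^^^ l = K ^^^ (l + 1) ** G"
    using G(4) by blast
  have t: "{1..t - 1} = {1..<t}"
    by auto
  note sums = drazin_add_nilpotent[OF KJ nil G(2,3) l, folded N, unfolded t]
  show "N\<^sup>d = G + (\<Sum>k\<in>{1..<t}. block ((A ^^^ k) ** A\<^sup>\<pi>) 0 0 ((D ^^^ k) ** D\<^sup>\<pi>) ** (G ^^^ (k + 1)))"
    unfolding sums(1) by (simp add: J_pow)
  have "mat 1 - N ** N\<^sup>d = (mat 1 - K ** G) - (\<Sum>k\<in>{1..<t}. J ^^^ k ** G ^^^ k)"
    unfolding sums(2) by simp
  then show "mat 1 - N ** N\<^sup>d = block (A\<^sup>\<pi> ** C ** B)\<^sup>\<pi> 0 0 (D\<^sup>\<pi> ** B ** C)\<^sup>\<pi>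
      - (\<Sum>k\<in>{1..<t}. block ((A ^^^ k) ** A\<^sup>\<pi>) 0 0 ((D ^^^ k) ** D\<^sup>\<pi>) ** (G ^^^ k))"
    by (simp add: G(1) mat_1_block block_diff J_pow drazin_compl_def)
qed

lemma drazin_block:
  fixes A :: "complex^'n^'n" and B :: "complex^'n^'m"
    and C :: "complex^'m^'n" and D :: "complex^'m^'m"
  defines "M \<equiv> block A C B D" and "E \<equiv> block A\<^sup>e 0 0 D\<^sup>e"
    and "F \<equiv> block 0 (A\<^sup>e ** C ** D\<^sup>\<pi>) (D\<^sup>e ** B ** A\<^sup>\<pi>) 0"
    and "N \<equiv> block (A ** A\<^sup>\<pi>) (A\<^sup>\<pi> ** C) (D\<^sup>\<pi> ** B) (D ** D\<^sup>\<pi>)"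
  assumes P: "corner_inverse E (E ** M ** E) P"
    and CD: "A\<^sup>\<pi> ** C ** D = 0" and BA: "D\<^sup>\<pi> ** B ** A = 0"
  shows "M\<^sup>d = (block A\<^sup>\<pi> 0 0 D\<^sup>\<pi> - P ** F) ** N\<^sup>d +
    (\<Sum>i\<in>{0..<mat_index N}. P ^^^ (i + 1) ** (mat 1 + P ** F) ** N ^^^ i ** (mat 1 - N ** N\<^sup>d))"
proof -
  have N: "N = M - E ** M"
    by (simp add: N_def M_def E_def block_mult block_diff drazin_compl_def matrix_ring_simps drazin_idem_rules)
  have F: "F = E ** M - E ** M ** E"
    by (simp add: F_def M_def E_def block_mult block_diff drazin_compl_def matrix_ring_simps drazin_idem_rules
        drazin_idem_rules[THEN matrix_mul_left_cong])
  have "N ** E = 0"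
    using drazin_compl_mul_idem_eq_0[OF CD] drazin_compl_mul_idem_eq_0[OF BA]
    by (simp add: N_def E_def block_mult matrix_mul_lzero matrix_mul_rzero drazin_compl_rules zero_block
        flip: matrix_mul_assoc)
  then have "M ** E = E ** M ** E"
    by (simp add: N matrix_diff_rdistrib)
  from drazin_triangular[OF P this N F drazin_commute drazin_outer drazin_index]
  show ?thesis
    by (simp add: E_def mat_1_block block_diff drazin_compl_def)
qed

theorem theorem4p4:
  fixes A :: "complex^'n^'n" and B :: "complex^'n^'m"
    and C :: "complex^'m^'n" and D :: "complex^'m^'m"
    and S s :: "complex^'n^'n" and Z z :: "complex^'m^'m"
    and M E M\<^sub>E P\<^sub>1 F G N :: "complex^('n + 'm)^('n + 'm)"
    and t q :: nat
  defines "S \<equiv> A - C ** D\<^sup>d ** B"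
    and "s \<equiv> A\<^sup>e ** S ** A\<^sup>e"
    and "Z \<equiv> D - B ** A\<^sup>d ** C"
    and "z \<equiv> D\<^sup>e ** Z ** D\<^sup>e"
    and "M \<equiv> block A C B D"
    and "E \<equiv> block A\<^sup>e 0 0 D\<^sup>e"
    and "M\<^sub>E \<equiv> E ** M ** E"
    and "P\<^sub>1 \<equiv> M\<^sub>E"
    and "F \<equiv> block 0 (A\<^sup>e ** C ** D\<^sup>\<pi>) (D\<^sup>e ** B ** A\<^sup>\<pi>) 0"
    and "G \<equiv> block 0 ((A\<^sup>\<pi> ** C ** B)\<^sup>d ** A\<^sup>\<pi> ** C) (D\<^sup>\<pi> ** B ** (A\<^sup>\<pi> ** C ** B)\<^sup>d) 0"
    and "N \<equiv> block (A ** A\<^sup>\<pi>) (A\<^sup>\<pi> ** C) (D\<^sup>\<pi> ** B) (D ** D\<^sup>\<pi>)"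
    and "t \<equiv> max (mat_index A) (mat_index D)"
    and "q \<equiv> mat_index N"
  assumes conditions:
    "(group_invertible M\<^sub>E \<and> M\<^sub>E\<^sup>e = E)
   \<or> (group_invertible s \<and> s\<^sup>e = A\<^sup>e)
   \<or> (group_invertible z \<and> z\<^sup>e = D\<^sup>e)
   \<or> invertible (A\<^sup>\<pi> + s)
   \<or> (invertible (mat 1 + A\<^sup>d ** (s - A)) \<or> invertible (mat 1 + A\<^sup>d ** (S - mat 1) ** A))
   \<or> (invertible (mat 1 + A\<^sup>d ** (s - A)) \<and> s\<^sup>d = matrix_inv (mat 1 + A\<^sup>d ** (s - A)) ** A\<^sup>d)
   \<or> invertible (D\<^sup>\<pi> + z)
   \<or> (invertible (mat 1 + D\<^sup>d ** (z - D)) \<or> invertible (mat 1 + D\<^sup>d ** (Z - mat 1) ** D))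
   \<or> (invertible (mat 1 + D\<^sup>d ** (z - D)) \<and> z\<^sup>d = matrix_inv (mat 1 + D\<^sup>d ** (z - D)) ** D\<^sup>d)
   \<or> (group_invertible s \<and> group_invertible z
        \<and> s\<^sup># = A\<^sup>d ** C ** z\<^sup># ** B ** A\<^sup>d + A\<^sup>d
        \<and> A\<^sup>d ** C ** z\<^sup># = s\<^sup># ** C ** D\<^sup>d)
   \<or> (group_invertible s \<and> group_invertible z
        \<and> z\<^sup># = D\<^sup>d ** B ** s\<^sup># ** C ** D\<^sup>d + D\<^sup>d
        \<and> D\<^sup>d ** B ** s\<^sup># = z\<^sup># ** B ** A\<^sup>d)
   \<or> (group_invertible M\<^sub>E \<and> group_invertible s \<and> group_invertible z
        \<and> M\<^sub>E\<^sup># = block (A\<^sup>d + A\<^sup>d ** C ** z\<^sup># ** B ** A\<^sup>d) (- (A\<^sup>d ** C ** z\<^sup>#))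
                       (- (z\<^sup># ** B ** A\<^sup>d)) (z\<^sup>#)
        \<and> M\<^sub>E\<^sup># = block (s\<^sup>#) (- (s\<^sup># ** C ** D\<^sup>d))
                       (- (D\<^sup>d ** B ** s\<^sup>#)) (D\<^sup>d ** B ** s\<^sup># ** C ** D\<^sup>d + D\<^sup>d))"
  assumes "A\<^sup>\<pi> ** C ** D = 0"
    and "D\<^sup>\<pi> ** B ** A = 0"
  shows "group_invertible P\<^sub>1 \<and> group_invertible s \<and> group_invertible z
    \<and> M\<^sup>d =
        (block A\<^sup>\<pi> 0 0 D\<^sup>\<pi> - P\<^sub>1\<^sup># ** F)
          ** (G + (\<Sum>k\<in>{1..<t}. block ((A ^^^ k) ** A\<^sup>\<pi>) 0 0 ((D ^^^ k) ** D\<^sup>\<pi>) ** (G ^^^ (k + 1))))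
        + (\<Sum>i\<in>{0..<q}. (P\<^sub>1\<^sup># ^^^ (i + 1)) ** (mat 1 + P\<^sub>1\<^sup># ** F) ** (N ^^^ i)
          ** (block (A\<^sup>\<pi> ** C ** B)\<^sup>\<pi> 0 0 (D\<^sup>\<pi> ** B ** C)\<^sup>\<pi>
              - (\<Sum>k\<in>{1..<t}. block ((A ^^^ k) ** A\<^sup>\<pi>) 0 0 ((D ^^^ k) ** D\<^sup>\<pi>) ** (G ^^^ k))))
    \<and> P\<^sub>1\<^sup># = block (A\<^sup>d + A\<^sup>d ** C ** z\<^sup># ** B ** A\<^sup>d) (- (A\<^sup>d ** C ** z\<^sup>#))
                   (- (z\<^sup># ** B ** A\<^sup>d)) (z\<^sup>#)
    \<and> P\<^sub>1\<^sup># = block (s\<^sup>#) (- (s\<^sup># ** C ** D\<^sup>d))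
                   (- (D\<^sup>d ** B ** s\<^sup>#)) (D\<^sup>d ** B ** s\<^sup># ** C ** D\<^sup>d + D\<^sup>d)"
proof -
  note unfolds = S_def s_def Z_def z_def
  \<comment> \<open>The Schur lemma with the roles of \<open>A\<close>, \<open>B\<close> and
    \<open>D\<close>, \<open>C\<close> exchanged.\<close>
  have z_to_s: "\<exists>\<sigma>. corner_inverse A\<^sup>e s \<sigma>" if "corner_inverse D\<^sup>e z \<zeta>" for \<zeta>
    using corner_inverse_schur(2)[of D B A C \<zeta>] that unfolding unfolds by blast
  have "(\<exists>\<sigma>. corner_inverse A\<^sup>e s \<sigma>) \<or> (\<exists>\<zeta>. corner_inverse D\<^sup>e z \<zeta>)"
    using conditions
  proof (elim disjE)
    assume "group_invertible M\<^sub>E \<and> M\<^sub>E\<^sup>e = E"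
    then have "corner_inverse E M\<^sub>E M\<^sub>E\<^sup>#"
      using corner_inverse_of_drazin_idem by blast
    then show ?thesis
      using corner_inverse_schur_block[of A D C B] unfolding unfolds E_def M\<^sub>E_def M_def by blast
  next
    assume "group_invertible s \<and> group_invertible z
        \<and> s\<^sup># = A\<^sup>d ** C ** z\<^sup># ** B ** A\<^sup>d + A\<^sup>d \<and> A\<^sup>d ** C ** z\<^sup># = s\<^sup># ** C ** D\<^sup>d"
    then show ?thesis
      using corner_inverse_of_coupling[of A C D B "z\<^sup>#"] unfolding s_def S_def by blast
  next
    assume "group_invertible s \<and> group_invertible z
        \<and> z\<^sup># = D\<^sup>d ** B ** s\<^sup># ** C ** D\<^sup>d + D\<^sup>d \<and> D\<^sup>d ** B ** s\<^sup># = z\<^sup># ** B ** A\<^sup>d"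
    then show ?thesis
      using corner_inverse_of_coupling[of D B A C "s\<^sup>#"] unfolding z_def Z_def by blast
  next
    assume *: "group_invertible M\<^sub>E \<and> group_invertible s \<and> group_invertible z
        \<and> M\<^sub>E\<^sup># = block (A\<^sup>d + A\<^sup>d ** C ** z\<^sup># ** B ** A\<^sup>d) (- (A\<^sup>d ** C ** z\<^sup>#))
                       (- (z\<^sup># ** B ** A\<^sup>d)) (z\<^sup>#)
        \<and> M\<^sub>E\<^sup># = block (s\<^sup>#) (- (s\<^sup># ** C ** D\<^sup>d))
                       (- (D\<^sup>d ** B ** s\<^sup>#)) (D\<^sup>d ** B ** s\<^sup># ** C ** D\<^sup>d + D\<^sup>d)"
    then have "block (A\<^sup>d + A\<^sup>d ** C ** z\<^sup># ** B ** A\<^sup>d) (- (A\<^sup>d ** C ** z\<^sup>#)) (- (z\<^sup># ** B ** A\<^sup>d)) (z\<^sup>#)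
      = block (s\<^sup>#) (- (s\<^sup># ** C ** D\<^sup>d)) (- (D\<^sup>d ** B ** s\<^sup>#)) (D\<^sup>d ** B ** s\<^sup># ** C ** D\<^sup>d + D\<^sup>d)"
      by metis
    \<comment> \<open>The upper rows of the two block forms in condition (12) contain the coupling
      equations of condition (10).\<close>
    then have "s\<^sup># = A\<^sup>d ** C ** z\<^sup># ** B ** A\<^sup>d + A\<^sup>d" "A\<^sup>d ** C ** z\<^sup># = s\<^sup># ** C ** D\<^sup>d"
      unfolding block_eq_iff by (auto simp: add.commute)
    with * show ?thesis
      using corner_inverse_of_coupling[of A C D B "z\<^sup>#"] unfolding s_def S_def by blast
  \<comment> \<open>Conditions (2) to (9) remain. In (6) and (9) the existence of the ordinary
    inverse is part of the assertion, so they fall under (5) and (8).\<close>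
  qed (use ex_corner_inverse[of A S] ex_corner_inverse[of D Z] in \<open>unfold s_def z_def, blast+\<close>)
  then obtain \<sigma> where \<sigma>: "corner_inverse A\<^sup>e s \<sigma>"
    using z_to_s by blast
  note schur = corner_inverse_schur[OF \<sigma>[unfolded unfolds], folded unfolds M_def E_def M\<^sub>E_def]
  note s = corner_inverse_imp_group_inv[OF \<sigma>]
    and z = corner_inverse_imp_group_inv[OF schur(2)]
    and P = corner_inverse_imp_group_inv[OF schur(1)]
  have P1: "corner_inverse E (E ** M ** E) P\<^sub>1\<^sup>#"
    using schur(1) P(2) unfolding P\<^sub>1_def M\<^sub>E_def by metis
  have P1_s: "P\<^sub>1\<^sup># = block (s\<^sup>#) (- (s\<^sup># ** C ** D\<^sup>d))
      (- (D\<^sup>d ** B ** s\<^sup>#)) (D\<^sup>d ** B ** s\<^sup># ** C ** D\<^sup>d + D\<^sup>d)"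
    unfolding P\<^sub>1_def P(2) s(2) ..
  have P1_z: "P\<^sub>1\<^sup># = block (A\<^sup>d + A\<^sup>d ** C ** z\<^sup># ** B ** A\<^sup>d) (- (A\<^sup>d ** C ** z\<^sup>#))
      (- (z\<^sup># ** B ** A\<^sup>d)) (z\<^sup>#)"
    unfolding P\<^sub>1_def P(2) z(2) schur(4)[symmetric] schur(5)[symmetric] block_eq_iff
    using schur(3,4) by simp
  note Md = drazin_block[of A D C B, folded M_def E_def F_def N_def q_def, OF P1 assms(15,16)]
  note Nd = drazin_complementary_part[OF assms(15,16), folded G_def N_def t_def]
  \<comment> \<open>\<open>mat 1 - N ** N\<^sup>d\<close> has to be rewritten before
    \<open>N\<^sup>d\<close> itself, whose replacement would destroy that pattern.\<close>
  show ?thesis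
    using s(1) z(1) P(1) P1_s P1_z Md[unfolded Nd(2), unfolded Nd(1)] unfolding P\<^sub>1_def by blast
qed

end
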